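(* Let $R$ be a commutative ring. For any quasi-Poisson algebra $A$ over $R$ and any integer $n\geq 1$, there is a unique structure of a quasi-Poisson algebra in $A_n^t$ such that the trace $\mathrm{tr}:\check A\to A_n^t$ is a quasi-Poisson algebra homomorphism.
   Context: Modules are $R$-modules; algebras are associative unital $R$-algebras. For a module $M$ and $m\ge 1$, an $m$-bracket in $M$ is a map $M^m\to M$ linear in all $m$ variables. It is cyclically symmetric if $\mu(x_1,\ldots,x_{m-1},x_m)=\mu(x_m,x_1,\ldots,x_{m-1})$ for all $x_i$; a 2-bracket is skew-symmetric if $\mu(x_1,x_2)=-\mu(x_2,x_1)$ for all $x_1,x_2$. Braces. For an algebra $A$, let $A'\subset A$ be the submodule spanned by all commutators $xy-yx$ and set $\check A=A/A'$ (so $\check A=A$ if $A$ is commutative). A derivation of $A$ is a linear map $d:A\to A$ with $d(xy)=d(x)y+xd(y)$; it carries $A'$ into itself and so induces a linear endomorphism of $\check A$. A weak derivation is a linear endomorphism of $\check A$ induced by a derivation of $A$. An $m$-brace in $A$ is an $m$-bracket in $\check A$ which is a weak derivation in each of its $m$ variables. Quasi-Poisson algebras. A quasi-Lie pair in a module $M$ is a skew-symmetric 2-bracket $[-,-]$ and a cyclically symmetric 3-bracket $[-,-,-]$ in $M$ such that for all $x,y,z\in M$ $$[[x,y],z]+[[y,z],x]+[[z,x],y]=[x,y,z]-[z,y,x].$$ A quasi-Poisson algebra is an algebra $A$ endowed with a quasi-Lie pair of brackets in the module $\check A$ which both are braces in $A$. A quasi-Poisson algebra homomorphism from $A$ to $B$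 is a linear map $f:\check A\to\check B$ with $[f(x),f(y)]=f([x,y])$ and $[f(x),f(y),f(z)]=f([x,y,z])$ for all $x,y,z\in\check A$. Trace algebras. For an algebra $A$ and $n\ge1$, $A_n$ is the commutative algebra generated over $R$ by symbols $x_{ij}$ ($x\in A$, $i,j\in\{1,\ldots,n\}$) subject to the relations $1_{ij}=\delta_{ij}$, $(rx)_{ij}=r\,x_{ij}$, $(x+y)_{ij}=x_{ij}+y_{ij}$, $(xy)_{ij}=\sum_{l=1}^n x_{il}y_{lj}$ for all $x,y\in A$, $r\in R$ and all $i,j$. The trace is the linear map $\mathrm{tr}:A\to A_n$, $x\mapsto\sum_{i=1}^n x_{ii}$; it annihilates $A'$ and induces a linear map $\check A\to A_n$, also denoted $\mathrm{tr}$. The $n$-th trace algebra $A_n^t$ is the subalgebra of $A_n$ generated by $\mathrm{tr}(A)$. *)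

theory Defs
  imports "HOL-Algebra.Module" "HOL-Algebra.AbelCoset" "HOL-Algebra.Subrings" "HOL-Library.FuncSet"
begin

section \<open>Algebras, linear maps and brackets\<close>

text \<open>The library locale \<^locale>\<open>algebra\<close> describes commutative algebras only. As everywhere in
  HOL-Algebra, the zero ring is allowed, both for \<open>R\<close> and for \<open>A\<close>.\<close>

locale assoc_algebra = module R A + ring A for R (structure) and A (structure) +
  assumes smult_mult_left:
      "\<lbrakk>r \<in> carrier R; x \<in> carrier A; y \<in> carrier A\<rbrakk> \<Longrightarrow>
       (r \<odot>\<^bsub>A\<^esub> x) \<otimes>\<^bsub>A\<^esub> y = r \<odot>\<^bsub>A\<^esub> (x \<otimes>\<^bsub>A\<^esub> y)"
    and smult_mult_right:
      "\<lbrakk>r \<in> carrier R; x \<in> carrier A; y \<in> carrier A\<rbrakk> \<Longrightarrow>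
       x \<otimes>\<^bsub>A\<^esub> (r \<odot>\<^bsub>A\<^esub> y) = r \<odot>\<^bsub>A\<^esub> (x \<otimes>\<^bsub>A\<^esub> y)"

definition linear_maps ::
  "('r, 'x) ring_scheme \<Rightarrow> ('r, 'a, 'y) module_scheme \<Rightarrow> ('r, 'b, 'z) module_scheme \<Rightarrow> ('a \<Rightarrow> 'b) set"
  where "linear_maps R M N =
    {f \<in> carrier M \<rightarrow> carrier N.
      (\<forall>x\<in>carrier M. \<forall>y\<in>carrier M. f (x \<oplus>\<^bsub>M\<^esub> y) = f x \<oplus>\<^bsub>N\<^esub> f y) \<and>
      (\<forall>r\<in>carrier R. \<forall>x\<in>carrier M. f (r \<odot>\<^bsub>M\<^esub> x) = r \<odot>\<^bsub>N\<^esub> f x)}"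

text \<open>An element of \<open>M\<^sup>m\<close> is a list of length \<open>m\<close>. Brackets are extensional, i.e. they take the value
  \<^const>\<open>undefined\<close> off \<open>M\<^sup>m\<close>, so that equality of brackets is equality of maps on \<open>M\<^sup>m\<close>.\<close>

definition tuples :: "('r, 'a, 'y) module_scheme \<Rightarrow> nat \<Rightarrow> 'a list set"
  where "tuples M m = {xs. length xs = m \<and> set xs \<subseteq> carrier M}"

definition bracket_in ::
  "('r, 'x) ring_scheme \<Rightarrow> ('r, 'a, 'y) module_scheme \<Rightarrow> nat \<Rightarrow> ('a list \<Rightarrow> 'a) \<Rightarrow> bool"
  where "bracket_in R M m \<mu> \<longleftrightarrow>
    \<mu> \<in> tuples M m \<rightarrow>\<^sub>E carrier M \<and>
    (\<forall>xs\<in>tuples M m. \<forall>i<m. (\<lambda>x. \<mu> (xs[i := x])) \<in> linear_maps R M M)"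

definition cyclically_symmetric ::
  "('r, 'a, 'y) module_scheme \<Rightarrow> nat \<Rightarrow> ('a list \<Rightarrow> 'a) \<Rightarrow> bool"
  where "cyclically_symmetric M m \<mu> \<longleftrightarrow>
    (\<forall>xs x. xs @ [x] \<in> tuples M m \<longrightarrow> \<mu> (xs @ [x]) = \<mu> (x # xs))"

definition skew_symmetric :: "('r, 'a, 'y) module_scheme \<Rightarrow> ('a list \<Rightarrow> 'a) \<Rightarrow> bool"
  where "skew_symmetric M \<mu> \<longleftrightarrow>
    (\<forall>x\<in>carrier M. \<forall>y\<in>carrier M. \<mu> [x, y] = \<ominus>\<^bsub>M\<^esub> \<mu> [y, x])"

definition quasi_Lie_pair ::
  "('r, 'x) ring_scheme \<Rightarrow> ('r, 'a, 'y) module_scheme \<Rightarrow> ('a list \<Rightarrow> 'a) \<Rightarrow> ('a list \<Rightarrow> 'a) \<Rightarrow> bool"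
  where "quasi_Lie_pair R M \<beta> \<tau> \<longleftrightarrow>
    bracket_in R M 2 \<beta> \<and> skew_symmetric M \<beta> \<and>
    bracket_in R M 3 \<tau> \<and> cyclically_symmetric M 3 \<tau> \<and>
    (\<forall>x\<in>carrier M. \<forall>y\<in>carrier M. \<forall>z\<in>carrier M.
      \<beta> [\<beta> [x, y], z] \<oplus>\<^bsub>M\<^esub> \<beta> [\<beta> [y, z], x] \<oplus>\<^bsub>M\<^esub> \<beta> [\<beta> [z, x], y]
        = \<tau> [x, y, z] \<ominus>\<^bsub>M\<^esub> \<tau> [z, y, x])"


section \<open>The module \<open>A / A'\<close>, braces and quasi-Poisson algebras\<close>

definition commutator_submodule :: "('r, 'x) ring_scheme \<Rightarrow> ('r, 'a, 'y) module_scheme \<Rightarrow> 'a set"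
  where "commutator_submodule R A =
    (\<lambda>N. submodule N R A) hull
      {x \<otimes>\<^bsub>A\<^esub> y \<ominus>\<^bsub>A\<^esub> y \<otimes>\<^bsub>A\<^esub> x |x y. x \<in> carrier A \<and> y \<in> carrier A}"

definition check_proj :: "('r, 'x) ring_scheme \<Rightarrow> ('r, 'a, 'y) module_scheme \<Rightarrow> 'a \<Rightarrow> 'a set"
  where "check_proj R A x = commutator_submodule R A +>\<^bsub>A\<^esub> x"

text \<open>\<open>A / A'\<close> is a module only: the fields \<^const>\<open>mult\<close> and \<^const>\<open>one\<close> of the record carry no
  meaning. For commutative \<open>A\<close> it consists of the singletons \<open>{x}\<close>, and \<^const>\<open>check_proj\<close> is the
  identification of \<open>A\<close> with \<open>A / A'\<close>.\<close>

definition check_module ::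
  "('r, 'x) ring_scheme \<Rightarrow> ('r, 'a, 'y) module_scheme \<Rightarrow> ('r, 'a set) module"
  where "check_module R A =
    \<lparr>carrier = a_rcosets\<^bsub>A\<^esub> (commutator_submodule R A),
     mult = undefined, one = undefined,
     zero = commutator_submodule R A,
     add = (\<lambda>X Y. X <+>\<^bsub>A\<^esub> Y),
     smult = (\<lambda>r X. \<Union>x\<in>X. check_proj R A (r \<odot>\<^bsub>A\<^esub> x))\<rparr>"

definition derivation ::
  "('r, 'x) ring_scheme \<Rightarrow> ('r, 'a, 'y) module_scheme \<Rightarrow> ('a \<Rightarrow> 'a) \<Rightarrow> bool"
  where "derivation R A d \<longleftrightarrow>
    d \<in> linear_maps R A A \<and>
    (\<forall>x\<in>carrier A. \<forall>y\<in>carrier A. d (x \<otimes>\<^bsub>A\<^esub> y) = d x \<otimes>\<^bsub>A\<^esub> y \<oplus>\<^bsub>A\<^esub> x \<otimes>\<^bsub>A\<^esub> d y)"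

definition weak_derivation ::
  "('r, 'x) ring_scheme \<Rightarrow> ('r, 'a, 'y) module_scheme \<Rightarrow> ('a set \<Rightarrow> 'a set) \<Rightarrow> bool"
  where "weak_derivation R A \<delta> \<longleftrightarrow>
    \<delta> \<in> linear_maps R (check_module R A) (check_module R A) \<and>
    (\<exists>d. derivation R A d \<and> (\<forall>x\<in>carrier A. \<delta> (check_proj R A x) = check_proj R A (d x)))"

definition brace_in ::
  "('r, 'x) ring_scheme \<Rightarrow> ('r, 'a, 'y) module_scheme \<Rightarrow> nat \<Rightarrow> ('a set list \<Rightarrow> 'a set) \<Rightarrow> bool"
  where "brace_in R A m \<mu> \<longleftrightarrow>
    bracket_in R (check_module R A) m \<mu> \<and>
    (\<forall>xs\<in>tuples (check_module R A) m. \<forall>i<m. weak_derivation R A (\<lambda>x. \<mu> (xs[i := x])))"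

definition quasi_Poisson_algebra ::
  "('r, 'x) ring_scheme \<Rightarrow> ('r, 'a, 'y) module_scheme \<Rightarrow>
   ('a set list \<Rightarrow> 'a set) \<Rightarrow> ('a set list \<Rightarrow> 'a set) \<Rightarrow> bool"
  where "quasi_Poisson_algebra R A \<beta> \<tau> \<longleftrightarrow>
    assoc_algebra R A \<and>
    quasi_Lie_pair R (check_module R A) \<beta> \<tau> \<and>
    brace_in R A 2 \<beta> \<and> brace_in R A 3 \<tau>"

definition quasi_Poisson_hom ::
  "('r, 'x) ring_scheme \<Rightarrow>
   ('r, 'a, 'y) module_scheme \<Rightarrow> ('a set list \<Rightarrow> 'a set) \<Rightarrow> ('a set list \<Rightarrow> 'a set) \<Rightarrow>
   ('r, 'b, 'z) module_scheme \<Rightarrow> ('b set list \<Rightarrow> 'b set) \<Rightarrow> ('b set list \<Rightarrow> 'b set) \<Rightarrow>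
   ('a set \<Rightarrow> 'b set) \<Rightarrow> bool"
  where "quasi_Poisson_hom R A \<beta> \<tau> B \<beta>' \<tau>' f \<longleftrightarrow>
    f \<in> linear_maps R (check_module R A) (check_module R B) \<and>
    (\<forall>x\<in>carrier (check_module R A). \<forall>y\<in>carrier (check_module R A).
      \<beta>' [f x, f y] = f (\<beta> [x, y])) \<and>
    (\<forall>x\<in>carrier (check_module R A). \<forall>y\<in>carrier (check_module R A).
      \<forall>z\<in>carrier (check_module R A). \<tau>' [f x, f y, f z] = f (\<tau> [x, y, z]))"


section \<open>Commutative algebras given by generators and relations\<close>

datatype ('r, 'g) calg_term =
    TGen 'g
  | TZero
  | TOne
  | TAdd "('r, 'g) calg_term" "('r, 'g) calg_term"
  | TMul "('r, 'g) calg_term" "('r, 'g) calg_term"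
  | TSmul 'r "('r, 'g) calg_term"

inductive_set calg_terms :: "('r, 'x) ring_scheme \<Rightarrow> 'g set \<Rightarrow> ('r, 'g) calg_term set"
  for R :: "('r, 'x) ring_scheme" and G :: "'g set"
  where
    gen: "g \<in> G \<Longrightarrow> TGen g \<in> calg_terms R G"
  | zero: "TZero \<in> calg_terms R G"
  | one: "TOne \<in> calg_terms R G"
  | add: "\<lbrakk>s \<in> calg_terms R G; t \<in> calg_terms R G\<rbrakk> \<Longrightarrow> TAdd s t \<in> calg_terms R G"
  | mul: "\<lbrakk>s \<in> calg_terms R G; t \<in> calg_terms R G\<rbrakk> \<Longrightarrow> TMul s t \<in> calg_terms R G"
  | smul: "\<lbrakk>r \<in> carrier R; t \<in> calg_terms R G\<rbrakk> \<Longrightarrow> TSmul r t \<in> calg_terms R G"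

text \<open>The least congruence on terms that contains the relations \<open>\<rho>\<close> and all instances of the axioms
  of a commutative unital \<open>R\<close>-algebra; \<open>(-1) t\<close> serves as the additive inverse of \<open>t\<close>.\<close>

inductive_set calg_cong ::
  "('r, 'x) ring_scheme \<Rightarrow> 'g set \<Rightarrow> ('r, 'g) calg_term rel \<Rightarrow> ('r, 'g) calg_term rel"
  for R :: "('r, 'x) ring_scheme" and G :: "'g set" and \<rho> :: "('r, 'g) calg_term rel"
  where
    rel: "\<lbrakk>(s, t) \<in> \<rho>; s \<in> calg_terms R G; t \<in> calg_terms R G\<rbrakk> \<Longrightarrow> (s, t) \<in> calg_cong R G \<rho>"
  | refl: "t \<in> calg_terms R G \<Longrightarrow> (t, t) \<in> calg_cong R G \<rho>"
  | sym: "(s, t) \<in> calg_cong R G \<rho> \<Longrightarrow> (t, s) \<in> calg_cong R G \<rho>"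
  | trans: "\<lbrakk>(s, t) \<in> calg_cong R G \<rho>; (t, u) \<in> calg_cong R G \<rho>\<rbrakk> \<Longrightarrow> (s, u) \<in> calg_cong R G \<rho>"
  | cong_add: "\<lbrakk>(s, s') \<in> calg_cong R G \<rho>; (t, t') \<in> calg_cong R G \<rho>\<rbrakk> \<Longrightarrow>
      (TAdd s t, TAdd s' t') \<in> calg_cong R G \<rho>"
  | cong_mul: "\<lbrakk>(s, s') \<in> calg_cong R G \<rho>; (t, t') \<in> calg_cong R G \<rho>\<rbrakk> \<Longrightarrow>
      (TMul s t, TMul s' t') \<in> calg_cong R G \<rho>"
  | cong_smul: "\<lbrakk>r \<in> carrier R; (t, t') \<in> calg_cong R G \<rho>\<rbrakk> \<Longrightarrow>
      (TSmul r t, TSmul r t') \<in> calg_cong R G \<rho>"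
  | add_assoc: "\<lbrakk>s \<in> calg_terms R G; t \<in> calg_terms R G; u \<in> calg_terms R G\<rbrakk> \<Longrightarrow>
      (TAdd (TAdd s t) u, TAdd s (TAdd t u)) \<in> calg_cong R G \<rho>"
  | add_comm: "\<lbrakk>s \<in> calg_terms R G; t \<in> calg_terms R G\<rbrakk> \<Longrightarrow>
      (TAdd s t, TAdd t s) \<in> calg_cong R G \<rho>"
  | add_zero: "t \<in> calg_terms R G \<Longrightarrow> (TAdd t TZero, t) \<in> calg_cong R G \<rho>"
  | add_inv: "t \<in> calg_terms R G \<Longrightarrow> (TAdd t (TSmul (\<ominus>\<^bsub>R\<^esub> \<one>\<^bsub>R\<^esub>) t), TZero) \<in> calg_cong R G \<rho>"
  | mul_assoc: "\<lbrakk>s \<in> calg_terms R G; t \<in> calg_terms R G; u \<in> calg_terms R G\<rbrakk> \<Longrightarrow>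
      (TMul (TMul s t) u, TMul s (TMul t u)) \<in> calg_cong R G \<rho>"
  | mul_comm: "\<lbrakk>s \<in> calg_terms R G; t \<in> calg_terms R G\<rbrakk> \<Longrightarrow>
      (TMul s t, TMul t s) \<in> calg_cong R G \<rho>"
  | mul_one: "t \<in> calg_terms R G \<Longrightarrow> (TMul t TOne, t) \<in> calg_cong R G \<rho>"
  | distrib: "\<lbrakk>s \<in> calg_terms R G; t \<in> calg_terms R G; u \<in> calg_terms R G\<rbrakk> \<Longrightarrow>
      (TMul (TAdd s t) u, TAdd (TMul s u) (TMul t u)) \<in> calg_cong R G \<rho>"
  | smul_add_left: "\<lbrakk>p \<in> carrier R; q \<in> carrier R; t \<in> calg_terms R G\<rbrakk> \<Longrightarrow>
      (TSmul (p \<oplus>\<^bsub>R\<^esub> q) t, TAdd (TSmul p t) (TSmul q t)) \<in> calg_cong R G \<rho>"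
  | smul_add_right: "\<lbrakk>r \<in> carrier R; s \<in> calg_terms R G; t \<in> calg_terms R G\<rbrakk> \<Longrightarrow>
      (TSmul r (TAdd s t), TAdd (TSmul r s) (TSmul r t)) \<in> calg_cong R G \<rho>"
  | smul_smul: "\<lbrakk>p \<in> carrier R; q \<in> carrier R; t \<in> calg_terms R G\<rbrakk> \<Longrightarrow>
      (TSmul (p \<otimes>\<^bsub>R\<^esub> q) t, TSmul p (TSmul q t)) \<in> calg_cong R G \<rho>"
  | smul_one: "t \<in> calg_terms R G \<Longrightarrow> (TSmul \<one>\<^bsub>R\<^esub> t, t) \<in> calg_cong R G \<rho>"
  | smul_mul: "\<lbrakk>r \<in> carrier R; s \<in> calg_terms R G; t \<in> calg_terms R G\<rbrakk> \<Longrightarrow>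
      (TMul (TSmul r s) t, TSmul r (TMul s t)) \<in> calg_cong R G \<rho>"

definition presented_calg ::
  "('r, 'x) ring_scheme \<Rightarrow> 'g set \<Rightarrow> ('r, 'g) calg_term rel \<Rightarrow> ('r, ('r, 'g) calg_term set) module"
  where "presented_calg R G \<rho> =
    \<lparr>carrier = calg_terms R G // calg_cong R G \<rho>,
     mult = (\<lambda>X Y. \<Union>s\<in>X. \<Union>t\<in>Y. calg_cong R G \<rho> `` {TMul s t}),
     one = calg_cong R G \<rho> `` {TOne},
     zero = calg_cong R G \<rho> `` {TZero},
     add = (\<lambda>X Y. \<Union>s\<in>X. \<Union>t\<in>Y. calg_cong R G \<rho> `` {TAdd s t}),
     smult = (\<lambda>r X. \<Union>t\<in>X. calg_cong R G \<rho> `` {TSmul r t})\<rparr>"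


section \<open>The algebra \<open>A\<^sub>n\<close>, the trace and the trace algebra\<close>

definition entry_gens :: "('r, 'a, 'y) module_scheme \<Rightarrow> nat \<Rightarrow> ('a \<times> nat \<times> nat) set"
  where "entry_gens A n = carrier A \<times> {1..n} \<times> {1..n}"

inductive_set entry_rels ::
  "('r, 'x) ring_scheme \<Rightarrow> ('r, 'a, 'y) module_scheme \<Rightarrow> nat \<Rightarrow> ('r, 'a \<times> nat \<times> nat) calg_term rel"
  for R :: "('r, 'x) ring_scheme" and A :: "('r, 'a, 'y) module_scheme" and n :: nat
  where
    one: "\<lbrakk>i \<in> {1..n}; j \<in> {1..n}\<rbrakk> \<Longrightarrow>
      (TGen (\<one>\<^bsub>A\<^esub>, i, j), if i = j then TOne else TZero) \<in> entry_rels R A n"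
  | smult: "\<lbrakk>r \<in> carrier R; x \<in> carrier A; i \<in> {1..n}; j \<in> {1..n}\<rbrakk> \<Longrightarrow>
      (TGen (r \<odot>\<^bsub>A\<^esub> x, i, j), TSmul r (TGen (x, i, j))) \<in> entry_rels R A n"
  | add: "\<lbrakk>x \<in> carrier A; y \<in> carrier A; i \<in> {1..n}; j \<in> {1..n}\<rbrakk> \<Longrightarrow>
      (TGen (x \<oplus>\<^bsub>A\<^esub> y, i, j), TAdd (TGen (x, i, j)) (TGen (y, i, j))) \<in> entry_rels R A n"
  | mult: "\<lbrakk>x \<in> carrier A; y \<in> carrier A; i \<in> {1..n}; j \<in> {1..n}\<rbrakk> \<Longrightarrow>
      (TGen (x \<otimes>\<^bsub>A\<^esub> y, i, j),
       foldr TAdd (map (\<lambda>l. TMul (TGen (x, i, l)) (TGen (y, l, j))) [1..<Suc n]) TZero)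
      \<in> entry_rels R A n"

type_synonym ('r, 'a) entry_class = "('r, 'a \<times> nat \<times> nat) calg_term set"

definition entry_algebra ::
  "('r, 'x) ring_scheme \<Rightarrow> ('r, 'a, 'y) module_scheme \<Rightarrow> nat \<Rightarrow> ('r, ('r, 'a) entry_class) module"
  where "entry_algebra R A n = presented_calg R (entry_gens A n) (entry_rels R A n)"

definition entry ::
  "('r, 'x) ring_scheme \<Rightarrow> ('r, 'a, 'y) module_scheme \<Rightarrow> nat \<Rightarrow> 'a \<Rightarrow> nat \<Rightarrow> nat \<Rightarrow> ('r, 'a) entry_class"
  where "entry R A n x i j = calg_cong R (entry_gens A n) (entry_rels R A n) `` {TGen (x, i, j)}"

definition trace ::
  "('r, 'x) ring_scheme \<Rightarrow> ('r, 'a, 'y) module_scheme \<Rightarrow> nat \<Rightarrow> 'a \<Rightarrow> ('r, 'a) entry_class"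
  where "trace R A n x = (\<Oplus>\<^bsub>entry_algebra R A n\<^esub> i\<in>{1..n}. entry R A n x i i)"

text \<open>A unital subalgebra is a subset that is both a subring and a submodule.\<close>

definition trace_algebra ::
  "('r, 'x) ring_scheme \<Rightarrow> ('r, 'a, 'y) module_scheme \<Rightarrow> nat \<Rightarrow> ('r, ('r, 'a) entry_class) module"
  where "trace_algebra R A n = (entry_algebra R A n)
    \<lparr>carrier := (\<lambda>H. subring H (entry_algebra R A n) \<and> submodule H R (entry_algebra R A n)) hull
                  (trace R A n ` carrier A)\<rparr>"

text \<open>The map that the trace induces on \<open>A / A'\<close>: since the trace is constant on each coset of \<open>A'\<close>,
  the image of a coset is a singleton.\<close>

definition induced_trace ::
  "('r, 'x) ring_scheme \<Rightarrow> ('r, 'a, 'y) module_scheme \<Rightarrow> nat \<Rightarrow> 'a set \<Rightarrow> ('r, 'a) entry_class"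
  where "induced_trace R A n X = the_elem (trace R A n ` X)"

end

theory Submission
  imports Defs
begin

text \<open>The commutative algebra \<open>A\<^sub>n\<^sup>t\<close> is generated by the traces, so braces in it, being
  derivations in each variable, are determined by their values on traces; this gives uniqueness. For
  existence, a derivation \<open>d\<close> of \<open>A\<close> induces the derivation \<open>x\<^sub>i\<^sub>j \<mapsto> (d x)\<^sub>i\<^sub>j\<close> of \<open>A\<^sub>n\<close>, which
  restricts to \<open>A\<^sub>n\<^sup>t\<close> and maps \<open>tr x\<close> to \<open>tr (d x)\<close>. Hence \<open>tr [x, y]\<close> extends, in either variable
  separately, to a derivation of \<open>A\<^sub>n\<^sup>t\<close>. Given derivations \<open>E\<^sub>y\<close> with \<open>E\<^sub>y (tr x) = tr [x, y]\<close>, the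
  elements \<open>u\<close> for which \<open>tr y \<mapsto> E\<^sub>y u\<close> extends to a derivation form a subalgebra containing all
  traces, hence all of \<open>A\<^sub>n\<^sup>t\<close>; these extensions are the values of the bracket at \<open>u\<close>. Iterating
  gives the 3-brace. The quasi-Lie identities hold on traces, and both sides of each are derivations in
  every variable.\<close>

section \<open>Derivations of algebras given by generators and relations\<close>

lemma linear_mapsD:
  assumes "f \<in> linear_maps R M N"
  shows "x \<in> carrier M \<Longrightarrow> f x \<in> carrier N"
    and "\<lbrakk>x \<in> carrier M; y \<in> carrier M\<rbrakk> \<Longrightarrow> f (x \<oplus>\<^bsub>M\<^esub> y) = f x \<oplus>\<^bsub>N\<^esub> f y"
    and "\<lbrakk>r \<in> carrier R; x \<in> carrier M\<rbrakk> \<Longrightarrow> f (r \<odot>\<^bsub>M\<^esub> x) = r \<odot>\<^bsub>N\<^esub> f x"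
  using assms by (auto simp: linear_maps_def)

lemma linear_mapsI:
  assumes "\<And>x. x \<in> carrier M \<Longrightarrow> f x \<in> carrier N"
    and "\<And>x y. \<lbrakk>x \<in> carrier M; y \<in> carrier M\<rbrakk> \<Longrightarrow> f (x \<oplus>\<^bsub>M\<^esub> y) = f x \<oplus>\<^bsub>N\<^esub> f y"
    and "\<And>r x. \<lbrakk>r \<in> carrier R; x \<in> carrier M\<rbrakk> \<Longrightarrow> f (r \<odot>\<^bsub>M\<^esub> x) = r \<odot>\<^bsub>N\<^esub> f x"
  shows "f \<in> linear_maps R M N"
  using assms by (auto simp: linear_maps_def)

lemma derivationI:
  assumes "\<And>x. x \<in> carrier A \<Longrightarrow> d x \<in> carrier A"
    and "\<And>x y. \<lbrakk>x \<in> carrier A; y \<in> carrier A\<rbrakk> \<Longrightarrow> d (x \<oplus>\<^bsub>A\<^esub> y) = d x \<oplus>\<^bsub>A\<^esub> d y"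
    and "\<And>r x. \<lbrakk>r \<in> carrier R; x \<in> carrier A\<rbrakk> \<Longrightarrow> d (r \<odot>\<^bsub>A\<^esub> x) = r \<odot>\<^bsub>A\<^esub> d x"
    and "\<And>x y. \<lbrakk>x \<in> carrier A; y \<in> carrier A\<rbrakk> \<Longrightarrow> d (x \<otimes>\<^bsub>A\<^esub> y) = d x \<otimes>\<^bsub>A\<^esub> y \<oplus>\<^bsub>A\<^esub> x \<otimes>\<^bsub>A\<^esub> d y"
  shows "derivation R A d"
  using assms by (auto simp: derivation_def intro: linear_mapsI)

lemma derivationD:
  assumes "derivation R A d"
  shows "x \<in> carrier A \<Longrightarrow> d x \<in> carrier A"
    and "\<lbrakk>x \<in> carrier A; y \<in> carrier A\<rbrakk> \<Longrightarrow> d (x \<oplus>\<^bsub>A\<^esub> y) = d x \<oplus>\<^bsub>A\<^esub> d y"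
    and "\<lbrakk>r \<in> carrier R; x \<in> carrier A\<rbrakk> \<Longrightarrow> d (r \<odot>\<^bsub>A\<^esub> x) = r \<odot>\<^bsub>A\<^esub> d x"
    and "\<lbrakk>x \<in> carrier A; y \<in> carrier A\<rbrakk> \<Longrightarrow> d (x \<otimes>\<^bsub>A\<^esub> y) = d x \<otimes>\<^bsub>A\<^esub> y \<oplus>\<^bsub>A\<^esub> x \<otimes>\<^bsub>A\<^esub> d y"
  using assms by (auto simp: derivation_def linear_mapsD)

lemma linear_maps_zero:
  assumes "module R M" "module R N" "f \<in> linear_maps R M N"
  shows "f \<zero>\<^bsub>M\<^esub> = \<zero>\<^bsub>N\<^esub>"
proof -
  interpret M: module R M by fact
  interpret N: module R N by fact
  have "f (\<zero>\<^bsub>R\<^esub> \<odot>\<^bsub>M\<^esub> \<zero>\<^bsub>M\<^esub>) = \<zero>\<^bsub>R\<^esub> \<odot>\<^bsub>N\<^esub> f \<zero>\<^bsub>M\<^esub>"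
    using linear_mapsD(3)[OF assms(3)] by blast
  then show ?thesis
    using linear_mapsD(1)[OF assms(3)] by simp
qed

lemma linear_maps_minus:
  assumes "module R M" "module R N" "f \<in> linear_maps R M N" "x \<in> carrier M"
  shows "f (\<ominus>\<^bsub>M\<^esub> x) = \<ominus>\<^bsub>N\<^esub> f x"
proof -
  interpret M: module R M by fact
  interpret N: module R N by fact
  have "f (\<ominus>\<^bsub>M\<^esub> x) \<oplus>\<^bsub>N\<^esub> f x = f (\<ominus>\<^bsub>M\<^esub> x \<oplus>\<^bsub>M\<^esub> x)"
    using assms(4) linear_mapsD(2)[OF assms(3)] by simp
  also have "\<dots> = \<zero>\<^bsub>N\<^esub>"
    using assms(4) linear_maps_zero[OF assms(1-3)] by (simp add: M.M.l_neg)
  finally show ?thesis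
    using assms(4) linear_mapsD(1)[OF assms(3)] by (intro N.M.minus_equality[symmetric]) auto
qed

lemma linear_maps_finsum:
  assumes "module R M" "module R N" "f \<in> linear_maps R M N" "finite I" "g \<in> I \<rightarrow> carrier M"
  shows "f (\<Oplus>\<^bsub>M\<^esub>i\<in>I. g i) = (\<Oplus>\<^bsub>N\<^esub>i\<in>I. f (g i))"
proof -
  interpret M: module R M by fact
  interpret N: module R N by fact
  show ?thesis using assms(4,5)
  proof (induction I rule: finite_induct)
    case empty
    then show ?case by (simp add: linear_maps_zero[OF assms(1-3)])
  next
    case (insert i I)
    then show ?case
      using linear_mapsD(1,2)[OF assms(3)]
      by (simp add: M.M.finsum_insert N.M.finsum_insert Pi_def M.M.finsum_closed)
  qed
qed

section \<open>The presented commutative algebra and its operations on classes of terms\<close>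

locale calg_presentation = R: cring R
  for R :: "('r, 'x) ring_scheme" (structure) +
  fixes G :: "'g set" and \<rho> :: "('r, 'g) calg_term rel"
begin

definition cls :: "('r, 'g) calg_term \<Rightarrow> ('r, 'g) calg_term set"
  where "cls t = calg_cong R G \<rho> `` {t}"

abbreviation "P \<equiv> presented_calg R G \<rho>"

lemma calg_cong_terms:
  assumes "(s, t) \<in> calg_cong R G \<rho>"
  shows "s \<in> calg_terms R G" "t \<in> calg_terms R G"
  using assms by (induction) (auto intro: calg_terms.intros)

lemma equiv_calg_cong: "equiv (calg_terms R G) (calg_cong R G \<rho>)"
  by (rule equivI)
     (auto simp: refl_on_def sym_def trans_def dest: calg_cong_terms intro: calg_cong.intros(2-4))

lemma presented_calg_cls_eq_iff:
  assumes "s \<in> calg_terms R G" "t \<in> calg_terms R G"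
  shows "cls s = cls t \<longleftrightarrow> (s, t) \<in> calg_cong R G \<rho>"
  using eq_equiv_class_iff[OF equiv_calg_cong assms] by (simp add: cls_def)

lemma presented_calg_cls_eqI: "(s, t) \<in> calg_cong R G \<rho> \<Longrightarrow> cls s = cls t"
  using presented_calg_cls_eq_iff calg_cong_terms by blast

text \<open>The unions over representatives in \<open>presented_calg\<close> collapse to a single
  class, because \<open>calg_cong\<close> is compatible with the term constructors.\<close>

lemma
  assumes "s \<in> calg_terms R G" "t \<in> calg_terms R G"
  shows presented_calg_mult: "cls s \<otimes>\<^bsub>P\<^esub> cls t = cls (TMul s t)"
    and presented_calg_add: "cls s \<oplus>\<^bsub>P\<^esub> cls t = cls (TAdd s t)"
proof -
  have "congruent2 (calg_cong R G \<rho>) (calg_cong R G \<rho>) (\<lambda>s t. cls (TMul s t))"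
    "congruent2 (calg_cong R G \<rho>) (calg_cong R G \<rho>) (\<lambda>s t. cls (TAdd s t))"
    by (auto intro!: congruent2I' presented_calg_cls_eqI calg_cong.cong_mul calg_cong.cong_add)
  then show "cls s \<otimes>\<^bsub>P\<^esub> cls t = cls (TMul s t)" "cls s \<oplus>\<^bsub>P\<^esub> cls t = cls (TAdd s t)"
    unfolding presented_calg_def cls_def
    by (simp_all add: UN_equiv_class2[OF equiv_calg_cong equiv_calg_cong _ assms])
qed

lemma presented_calg_smult:
  assumes "r \<in> carrier R" "t \<in> calg_terms R G"
  shows "r \<odot>\<^bsub>P\<^esub> cls t = cls (TSmul r t)"
proof -
  have "congruent (calg_cong R G \<rho>) (\<lambda>t. cls (TSmul r t))"
    using assms(1) by (auto intro!: congruentI presented_calg_cls_eqI calg_cong.cong_smul)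
  then show ?thesis
    unfolding presented_calg_def cls_def by (simp add: UN_equiv_class[OF equiv_calg_cong _ assms(2)])
qed

lemmas presented_calg_ops = presented_calg_mult presented_calg_add presented_calg_smult

lemma presented_calg_consts: "\<one>\<^bsub>P\<^esub> = cls TOne" "\<zero>\<^bsub>P\<^esub> = cls TZero"
  by (simp_all add: presented_calg_def cls_def)

lemma presented_calg_carrier: "carrier P = cls ` calg_terms R G"
  by (auto simp: presented_calg_def quotient_def cls_def)

lemma presented_calg_rel:
  assumes "(s, t) \<in> \<rho>" "s \<in> calg_terms R G" "t \<in> calg_terms R G"
  shows "cls s = cls t"
  using assms by (simp add: presented_calg_cls_eq_iff calg_cong.rel)

lemma algebra_presented_calg: "algebra R P"
proof -
  note simps = presented_calg_ops presented_calg_consts calg_terms.intros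
  \<comment> \<open>The introduction rules below expect the inverse, the zero and the one on the
    left. The congruence has them on the right, so commutativity turns them round.\<close>
  have neg: "(TAdd (TSmul (\<ominus>\<^bsub>R\<^esub> \<one>\<^bsub>R\<^esub>) t) t, TZero) \<in> calg_cong R G \<rho>" if "t \<in> calg_terms R G" for t
    using that by (blast intro: calg_cong.intros calg_terms.intros R.a_inv_closed R.one_closed)
  have zero_add: "(TAdd TZero t, t) \<in> calg_cong R G \<rho>" if "t \<in> calg_terms R G" for t
    using that by (blast intro: calg_cong.intros calg_terms.intros)
  have one_mul: "(TMul TOne t, t) \<in> calg_cong R G \<rho>" if "t \<in> calg_terms R G" for t
    using that by (blast intro: calg_cong.intros calg_terms.intros)
  have ab: "abelian_group P"
  proof (rule abelian_groupI)
    fix x assume "x \<in> carrier P"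
    then obtain t where t: "t \<in> calg_terms R G" "x = cls t"
      by (auto simp: presented_calg_carrier)
    then show "\<exists>y\<in>carrier P. y \<oplus>\<^bsub>P\<^esub> x = \<zero>\<^bsub>P\<^esub>"
      using presented_calg_cls_eqI[OF neg[OF t(1)]]
      by (intro bexI[of _ "cls (TSmul (\<ominus>\<^bsub>R\<^esub> \<one>\<^bsub>R\<^esub>) t)"]) (auto simp: simps presented_calg_carrier)
  qed (auto simp: presented_calg_carrier simps zero_add
      del: equalityI intro!: presented_calg_cls_eqI intro: calg_cong.add_zero calg_cong.add_assoc calg_cong.add_comm)
  have cm: "comm_monoid P"
    by (rule comm_monoidI)
      (auto simp: presented_calg_carrier simps one_mul
        del: equalityI intro!: presented_calg_cls_eqI intro: calg_cong.mul_assoc calg_cong.mul_comm)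
  have cr: "cring P"
    by (rule cringI[OF ab cm]) (auto simp: presented_calg_carrier simps
        del: equalityI intro!: presented_calg_cls_eqI intro: calg_cong.distrib)
  show ?thesis
    by (rule algebraI[OF R.cring_axioms cr])
      (auto simp: presented_calg_carrier simps del: equalityI intro!: presented_calg_cls_eqI
        intro: calg_cong.intros(8-))
qed

text \<open>The product rule as a recursion: a derivation of \<open>P\<close> with values
  \<open>f\<close> on the generators can only take this value on the class of a term. The result
  lies in \<open>P\<close> itself, so no representative of a derivative has to be chosen.\<close>

primrec term_derivative :: "('g \<Rightarrow> ('r, 'g) calg_term set) \<Rightarrow> ('r, 'g) calg_term \<Rightarrow> ('r, 'g) calg_term set"
  where
    "term_derivative f (TGen g) = f g"
  | "term_derivative f TZero = \<zero>\<^bsub>P\<^esub>"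
  | "term_derivative f TOne = \<zero>\<^bsub>P\<^esub>"
  | "term_derivative f (TAdd s t) = term_derivative f s \<oplus>\<^bsub>P\<^esub> term_derivative f t"
  | "term_derivative f (TMul s t) =
      term_derivative f s \<otimes>\<^bsub>P\<^esub> cls t \<oplus>\<^bsub>P\<^esub> cls s \<otimes>\<^bsub>P\<^esub> term_derivative f t"
  | "term_derivative f (TSmul r t) = r \<odot>\<^bsub>P\<^esub> term_derivative f t"

context
  fixes f :: "'g \<Rightarrow> ('r, 'g) calg_term set"
  assumes f_closed: "\<And>g. g \<in> G \<Longrightarrow> f g \<in> carrier P"
    and f_rel: "\<And>s t. \<lbrakk>(s, t) \<in> \<rho>; s \<in> calg_terms R G; t \<in> calg_terms R G\<rbrakk> \<Longrightarrow>
      term_derivative f s = term_derivative f t"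
begin

lemma term_derivative_closed:
  assumes "t \<in> calg_terms R G"
  shows "term_derivative f t \<in> carrier P"
proof -
  interpret P: algebra R P by (rule algebra_presented_calg)
  have "cls t \<in> carrier P" if "t \<in> calg_terms R G" for t
    using that by (auto simp: presented_calg_carrier)
  with assms show ?thesis
    by (induction rule: calg_terms.induct) (auto simp: f_closed)
qed

text \<open>Only the relations in \<open>\<rho>\<close> need the assumption \<open>f_rel\<close>.
  Every axiom of a commutative algebra is respected by the product rule automatically, since
  \<open>P\<close> is itself a commutative algebra.\<close>

lemma term_derivative_cong:
  assumes "(s, t) \<in> calg_cong R G \<rho>"
  shows "term_derivative f s = term_derivative f t"
proof -
  interpret P: algebra R P by (rule algebra_presented_calg)
  have cls_closed: "cls t \<in> carrier P" if "t \<in> calg_terms R G" for t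
    using that by (auto simp: presented_calg_carrier)
  note closed = cls_closed term_derivative_closed
  \<comment> \<open>Read backwards, these equations turn the class of a compound term into an
    expression in \<open>P\<close>, where the ring laws apply.\<close>
  note ops = presented_calg_ops[symmetric] presented_calg_consts[symmetric] calg_terms.intros
  \<comment> \<open>The derivative of a product contains the classes of the factors, so their
    equality is needed besides the induction hypotheses.\<close>
  have eq: "cls s = cls t" if "(s, t) \<in> calg_cong R G \<rho>" for s t
    using that by (rule presented_calg_cls_eqI)
  show ?thesis using assms
  proof (induction rule: calg_cong.induct)
    case (cong_mul s s' t t')
    then show ?case using eq[OF cong_mul.hyps(1)] eq[OF cong_mul.hyps(2)] by simp
  next
    case (add_inv t)
    then show ?case using closed[of t]
      by (simp add: P.smult_l_minus P.M.r_neg)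
  next
    case (mul_assoc s t u)
    then show ?case using closed[of s] closed[of t] closed[of u]
      by (simp add: ops P.l_distr P.r_distr P.m_assoc P.M.a_assoc)
  next
    case (mul_comm s t)
    then show ?case using closed[of s] closed[of t]
      by (simp add: P.M.a_comm P.m_comm)
  next
    case (distrib s t u)
    then show ?case using closed[of s] closed[of t] closed[of u]
      by (simp add: ops P.l_distr P.r_distr P.M.a_ac)
  next
    case (smul_mul r s t)
    then show ?case using closed[of s] closed[of t]
      by (simp add: ops P.smult_r_distr P.smult_assoc2)
  qed (use closed in \<open>auto simp: ops f_rel P.M.a_ac P.smult_l_distr P.smult_r_distr
        P.smult_assoc1\<close>)
qed

theorem presented_calg_derivation:
  obtains D where "derivation R P D" and "\<And>t. t \<in> calg_terms R G \<Longrightarrow> D (cls t) = term_derivative f t"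
proof -
  interpret P: algebra R P by (rule algebra_presented_calg)
  \<comment> \<open>A representative is picked arbitrarily; \<open>term_derivative_cong\<close>
    makes the choice immaterial.\<close>
  define D where "D X = term_derivative f (SOME t. t \<in> calg_terms R G \<and> cls t = X)" for X
  have D: "D (cls t) = term_derivative f t" if "t \<in> calg_terms R G" for t
  proof -
    let ?s = "SOME s. s \<in> calg_terms R G \<and> cls s = cls t"
    have "?s \<in> calg_terms R G \<and> cls ?s = cls t"
      by (rule someI[of _ t]) (use that in auto)
    then show ?thesis
      using that term_derivative_cong presented_calg_cls_eq_iff unfolding D_def by blast
  qed
  have "derivation R P D"
    by (rule derivationI)
      (auto simp: presented_calg_carrier presented_calg_ops D calg_terms.intros
        term_derivative_closed[unfolded presented_calg_carrier])
  then show thesis using D that by blast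
qed

end

end


section \<open>Brackets on a generated commutative algebra\<close>

text \<open>The counterpart of a brace on elements of \<open>A\<close> instead of cosets. No
  extensionality is imposed, so that such maps can be combined freely by lambda terms.\<close>

definition multi_derivation ::
  "('r, 'x) ring_scheme \<Rightarrow> ('r, 'a, 'y) module_scheme \<Rightarrow> nat \<Rightarrow> ('a list \<Rightarrow> 'a) \<Rightarrow> bool"
  where "multi_derivation R A m f \<longleftrightarrow>
    (\<forall>xs\<in>tuples A m. \<forall>i<m. derivation R A (\<lambda>x. f (xs[i := x])))"

text \<open>Being a derivation concerns the values on the carrier only, and the carrier is closed
  under the operations that occur in the laws.\<close>

lemma derivation_cong:
  assumes "derivation R A d" "ring A" "module R A" "\<And>x. x \<in> carrier A \<Longrightarrow> d x = d' x"
  shows "derivation R A d'"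
proof -
  interpret A: ring A by fact
  interpret M: module R A by fact
  show ?thesis
    using assms(4) derivationD[OF assms(1)] by (intro derivationI) (simp_all flip: assms(4))
qed

text \<open>The product rule for one times one gives \<open>d 1 = d 1 + d 1\<close>.\<close>

lemma (in assoc_algebra) derivation_one:
  assumes "derivation R A d"
  shows "d \<one>\<^bsub>A\<^esub> = \<zero>\<^bsub>A\<^esub>"
proof -
  have "d \<one>\<^bsub>A\<^esub> = d \<one>\<^bsub>A\<^esub> \<oplus>\<^bsub>A\<^esub> d \<one>\<^bsub>A\<^esub>"
    using derivationD(1)[OF assms one_closed]
      derivationD(4)[OF assms one_closed one_closed] by simp
  then show ?thesis
    using derivationD(1)[OF assms one_closed] by (metis M.add.r_cancel_one')
qed

section \<open>Derivations of a commutative algebra as a module over it\<close>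

context algebra
begin

lemma assoc_algebra: "assoc_algebra R M"
  by (intro assoc_algebra.intro assoc_algebra_axioms.intro module ring_axioms)
     (metis smult_assoc2, metis m_comm smult_assoc2 smult_closed)

lemma derivation_zero: "derivation R M (\<lambda>_. \<zero>\<^bsub>M\<^esub>)"
  by (rule derivationI) auto

lemma derivation_add:
  assumes "derivation R M d" "derivation R M d'"
  shows "derivation R M (\<lambda>x. d x \<oplus>\<^bsub>M\<^esub> d' x)"
  using derivationD[OF assms(1)] derivationD[OF assms(2)]
  by (intro derivationI) (simp_all add: M.a_ac smult_r_distr l_distr r_distr)

lemma derivation_mult:
  assumes "derivation R M d" "a \<in> carrier M"
  shows "derivation R M (\<lambda>x. d x \<otimes>\<^bsub>M\<^esub> a)"
proof (rule derivationI)
  show "d (x \<otimes>\<^bsub>M\<^esub> y) \<otimes>\<^bsub>M\<^esub> a = d x \<otimes>\<^bsub>M\<^esub> a \<otimes>\<^bsub>M\<^esub> y \<oplus>\<^bsub>M\<^esub> x \<otimes>\<^bsub>M\<^esub> (d y \<otimes>\<^bsub>M\<^esub> a)"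
    if "x \<in> carrier M" "y \<in> carrier M" for x y
    using derivationD[OF assms(1)] assms(2) that by (simp add: l_distr r_distr m_ac)
qed (use derivationD[OF assms(1)] assms(2) in \<open>simp_all add: l_distr smult_assoc2\<close>)

lemma derivation_smult:
  assumes "derivation R M d" "r \<in> carrier R"
  shows "derivation R M (\<lambda>x. r \<odot>\<^bsub>M\<^esub> d x)"
proof (rule derivationI)
  have smult_right: "x \<otimes>\<^bsub>M\<^esub> (r \<odot>\<^bsub>M\<^esub> y) = r \<odot>\<^bsub>M\<^esub> (x \<otimes>\<^bsub>M\<^esub> y)" if "x \<in> carrier M" "y \<in> carrier M" for x y
    using that assms(2) by (metis m_comm smult_assoc2 smult_closed)
  show "r \<odot>\<^bsub>M\<^esub> d (x \<otimes>\<^bsub>M\<^esub> y) = (r \<odot>\<^bsub>M\<^esub> d x) \<otimes>\<^bsub>M\<^esub> y \<oplus>\<^bsub>M\<^esub> x \<otimes>\<^bsub>M\<^esub> (r \<odot>\<^bsub>M\<^esub> d y)"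
    if "x \<in> carrier M" "y \<in> carrier M" for x y
    using derivationD[OF assms(1)] assms(2) that
    by (simp add: smult_r_distr smult_assoc2 smult_right)
  show "r \<odot>\<^bsub>M\<^esub> d (s \<odot>\<^bsub>M\<^esub> x) = s \<odot>\<^bsub>M\<^esub> (r \<odot>\<^bsub>M\<^esub> d x)"
    if "s \<in> carrier R" "x \<in> carrier M" for s x
    using derivationD[OF assms(1)] assms(2) that
    by (simp add: R.m_comm flip: smult_assoc1)
qed (use derivationD[OF assms(1)] assms(2) in \<open>auto simp: smult_r_distr\<close>)

lemma derivation_minus:
  assumes "derivation R M d"
  shows "derivation R M (\<lambda>x. \<ominus>\<^bsub>M\<^esub> d x)"
proof (rule derivation_cong[OF derivation_smult[OF assms, of "\<ominus>\<^bsub>R\<^esub> \<one>\<^bsub>R\<^esub>"]])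
  show "ring M" ..
  show "module R M" by (rule module)
qed (use derivationD[OF assms] in \<open>simp_all add: smult_l_minus\<close>)

lemma derivation_one:
  assumes "derivation R M d"
  shows "d \<one>\<^bsub>M\<^esub> = \<zero>\<^bsub>M\<^esub>"
  using assoc_algebra.derivation_one[OF assoc_algebra assms] .

text \<open>In the Jacobiator of a skew biderivation the four cross terms of the product rule cancel.\<close>

lemma jacobiator_derivation:
  assumes l: "\<And>v. v \<in> carrier M \<Longrightarrow> derivation R M (\<lambda>u. B u v)"
    and r: "\<And>u. u \<in> carrier M \<Longrightarrow> derivation R M (B u)"
    and skew: "\<And>u v. \<lbrakk>u \<in> carrier M; v \<in> carrier M\<rbrakk> \<Longrightarrow> B u v = \<ominus>\<^bsub>M\<^esub> B v u"
    and vw: "v \<in> carrier M" "w \<in> carrier M"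
  shows "derivation R M (\<lambda>u. B (B u v) w \<oplus>\<^bsub>M\<^esub> B (B v w) u \<oplus>\<^bsub>M\<^esub> B (B w u) v)"
proof -
  have closed: "B x y \<in> carrier M" if "x \<in> carrier M" "y \<in> carrier M" for x y
    using derivationD(1)[OF l[OF that(2)] that(1)] .
  note lD = derivationD(2-)[OF l]
  note rD = derivationD(2-)[OF r]
  \<comment> \<open>The remaining summand \<open>B (B v w) u\<close> is a derivation in
    \<open>u\<close> already by \<open>r\<close>; only the sum of the other two needs a
    computation.\<close>
  have "derivation R M (\<lambda>u. B (B u v) w \<oplus>\<^bsub>M\<^esub> B (B w u) v)"
  proof (rule derivationI)
    fix x y assume xy: "x \<in> carrier M" "y \<in> carrier M"
    \<comment> \<open>The products \<open>b c\<close> and \<open>d e\<close> are the cross terms of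
      the first summand. Skew-symmetry turns \<open>B w x\<close> and \<open>B w y\<close> into
      \<open>- d\<close> and \<open>- c\<close>, which makes the cross terms of the second summand
      their negatives.\<close>
    have *: "(a \<otimes>\<^bsub>M\<^esub> y \<oplus>\<^bsub>M\<^esub> b \<otimes>\<^bsub>M\<^esub> c \<oplus>\<^bsub>M\<^esub> (d \<otimes>\<^bsub>M\<^esub> e \<oplus>\<^bsub>M\<^esub> x \<otimes>\<^bsub>M\<^esub> f))
        \<oplus>\<^bsub>M\<^esub> (a' \<otimes>\<^bsub>M\<^esub> y \<oplus>\<^bsub>M\<^esub> (\<ominus>\<^bsub>M\<^esub> d) \<otimes>\<^bsub>M\<^esub> e \<oplus>\<^bsub>M\<^esub> (b \<otimes>\<^bsub>M\<^esub> (\<ominus>\<^bsub>M\<^esub> c) \<oplus>\<^bsub>M\<^esub> x \<otimes>\<^bsub>M\<^esub> f'))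
      = (a \<oplus>\<^bsub>M\<^esub> a') \<otimes>\<^bsub>M\<^esub> y \<oplus>\<^bsub>M\<^esub> x \<otimes>\<^bsub>M\<^esub> (f \<oplus>\<^bsub>M\<^esub> f')"
      if "a \<in> carrier M" "b \<in> carrier M" "c \<in> carrier M" "d \<in> carrier M" "e \<in> carrier M"
        "f \<in> carrier M" "a' \<in> carrier M" "f' \<in> carrier M" for a b c d e f a' f'
      using that xy by algebra
    show "B (B (x \<otimes>\<^bsub>M\<^esub> y) v) w \<oplus>\<^bsub>M\<^esub> B (B w (x \<otimes>\<^bsub>M\<^esub> y)) v =
      (B (B x v) w \<oplus>\<^bsub>M\<^esub> B (B w x) v) \<otimes>\<^bsub>M\<^esub> y \<oplus>\<^bsub>M\<^esub> x \<otimes>\<^bsub>M\<^esub> (B (B y v) w \<oplus>\<^bsub>M\<^esub> B (B w y) v)"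
      using *[of "B (B x v) w" "B x v" "B y w" "B x w" "B y v" "B (B y v) w" "B (B w x) v" "B (B w y) v"]
        skew[of w x] skew[of w y] xy vw by (simp add: closed lD rD)
  qed (use vw in \<open>simp_all add: closed lD rD M.a_ac smult_r_distr\<close>)
  from derivation_add[OF this r[of "B v w"]]
  show ?thesis
    by (rule derivation_cong)
      (use vw closed module ring_axioms in \<open>auto simp: M.a_ac\<close>)
qed

end

text \<open>Generation is encoded as an induction principle, the only form in which it is used. Zero
  and negatives need no cases, being scalar multiples. Indexing the generators lets prescribed
  values be functions of indices.\<close>

locale generated_algebra = algebra R M for R :: "('r, 'x) ring_scheme" and M :: "('r, 'a, 'y) module_scheme" +
  fixes gen :: "'i \<Rightarrow> 'a" and I :: "'i set"
  assumes gen_closed [simp, intro]: "i \<in> I \<Longrightarrow> gen i \<in> carrier M"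
    and generated_induct [consumes 1, case_names gen one add mult smult]:
      "\<lbrakk>u \<in> carrier M;
        \<And>i. i \<in> I \<Longrightarrow> P (gen i); P \<one>\<^bsub>M\<^esub>;
        \<And>u v. \<lbrakk>u \<in> carrier M; v \<in> carrier M; P u; P v\<rbrakk> \<Longrightarrow> P (u \<oplus>\<^bsub>M\<^esub> v);
        \<And>u v. \<lbrakk>u \<in> carrier M; v \<in> carrier M; P u; P v\<rbrakk> \<Longrightarrow> P (u \<otimes>\<^bsub>M\<^esub> v);
        \<And>r u. \<lbrakk>r \<in> carrier R; u \<in> carrier M; P u\<rbrakk> \<Longrightarrow> P (r \<odot>\<^bsub>M\<^esub> u)\<rbrakk> \<Longrightarrow> P u"
begin

lemma derivation_eqI:
  assumes "derivation R M d" "derivation R M d'" "\<And>i. i \<in> I \<Longrightarrow> d (gen i) = d' (gen i)"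
    and "u \<in> carrier M"
  shows "d u = d' u"
  using assms(4)
  by (induction rule: generated_induct)
    (simp_all add: derivation_one assms(3) assms(1,2)
      derivationD(2-)[OF assms(1)] derivationD(2-)[OF assms(2)])

lemma multi_derivation_eqI:
  assumes f: "multi_derivation R M m f" and g: "multi_derivation R M m g"
    and eq: "\<And>is. \<lbrakk>length is = m; set is \<subseteq> I\<rbrakk> \<Longrightarrow> f (map gen is) = g (map gen is)"
    and xs: "xs \<in> tuples M m"
  shows "f xs = g xs"
proof -
  \<comment> \<open>An arbitrary prefix followed by generators: the induction shortens the prefix
    from its right end, since a derivation in that slot is determined by its values on
    generators.\<close>
  have "f (ys @ map gen is) = g (ys @ map gen is)"
    if "set ys \<subseteq> carrier M" "set is \<subseteq> I" "length ys + length is = m" for ys "is"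
    using that
  proof (induction ys arbitrary: "is" rule: rev_induct)
    case Nil
    then show ?case using eq by simp
  next
    case (snoc y ys)
    \<comment> \<open>The zero is a placeholder in the slot that is about to vary.\<close>
    define zs where "zs = ys @ \<zero>\<^bsub>M\<^esub> # map gen is"
    have zs: "zs \<in> tuples M m"
      using snoc.prems by (auto simp: zs_def tuples_def)
    have upd: "zs[length ys := z] = ys @ z # map gen is" for z
      by (simp add: zs_def)
    have len: "length ys < m"
      using snoc.prems by simp
    have "f (zs[length ys := y]) = g (zs[length ys := y])"
    proof (rule derivation_eqI[of "\<lambda>x. f (zs[length ys := x])" "\<lambda>x. g (zs[length ys := x])"])
      show "derivation R M (\<lambda>x. f (zs[length ys := x]))" "derivation R M (\<lambda>x. g (zs[length ys := x]))"
        using f g zs len by (auto simp: multi_derivation_def)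
      show "f (zs[length ys := gen i]) = g (zs[length ys := gen i])" if "i \<in> I" for i
        using snoc.IH[of "i # is"] snoc.prems that by (simp add: upd)
    qed (use snoc.prems in auto)
    then show ?case by (simp add: upd)
  qed
  from this[of xs "[]"] xs show ?thesis
    by (simp add: tuples_def)
qed

text \<open>The elements \<open>u\<close> such that \<open>gen j \<mapsto> E j u\<close> extends to a derivation form a subalgebra: if
  \<open>D\<close> and \<open>D'\<close> are extensions for \<open>u\<close> and \<open>v\<close>, then \<open>D v + D' u\<close> is one for \<open>u v\<close>.\<close>

lemma derivation_extension:
  assumes E: "\<And>j. j \<in> I \<Longrightarrow> derivation R M (E j)"
    and gens: "\<And>i. i \<in> I \<Longrightarrow> \<exists>D. derivation R M D \<and> (\<forall>j\<in>I. D (gen j) = E j (gen i))"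
    and u: "u \<in> carrier M"
  shows "\<exists>D. derivation R M D \<and> (\<forall>j\<in>I. D (gen j) = E j u)"
  using u
proof (induction rule: generated_induct)
  case (gen i)
  then show ?case by (rule gens)
next
  case one
  \<comment> \<open>Every \<open>E j\<close> vanishes at one, so the zero derivation is an
    extension.\<close>
  then show ?case using derivation_zero derivation_one[OF E] by auto
next
  case (add u v)
  then obtain D D' where D: "derivation R M D" "derivation R M D'"
    "\<And>j. j \<in> I \<Longrightarrow> D (gen j) = E j u" "\<And>j. j \<in> I \<Longrightarrow> D' (gen j) = E j v" by blast
  then show ?case
    using derivation_add[OF D(1,2)] add.hyps derivationD(2)[OF E]
    by (intro exI[of _ "\<lambda>x. D x \<oplus>\<^bsub>M\<^esub> D' x"]) simp
next
  case (mult u v)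
  then obtain D D' where D: "derivation R M D" "derivation R M D'"
    "\<And>j. j \<in> I \<Longrightarrow> D (gen j) = E j u" "\<And>j. j \<in> I \<Longrightarrow> D' (gen j) = E j v" by blast
  then show ?case
    using derivation_add[OF derivation_mult[OF D(1)] derivation_mult[OF D(2)], of v u]
      mult.hyps derivationD(1,4)[OF E]
    by (intro exI[of _ "\<lambda>x. D x \<otimes>\<^bsub>M\<^esub> v \<oplus>\<^bsub>M\<^esub> D' x \<otimes>\<^bsub>M\<^esub> u"]) (simp add: m_comm)
next
  case (smult r u)
  then obtain D where D: "derivation R M D" "\<And>j. j \<in> I \<Longrightarrow> D (gen j) = E j u" by blast
  then show ?case
    using derivation_smult[OF D(1) smult.hyps(1)] smult.hyps derivationD(3)[OF E]
    by (intro exI[of _ "\<lambda>x. r \<odot>\<^bsub>M\<^esub> D x"]) simp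
qed

text \<open>For a generator \<open>v\<close> the map is some \<open>E j\<close>. The product rule of
  \<open>B u\<close> in its own variable writes \<open>B u (v w)\<close> as a combination of
  \<open>B u v\<close> and \<open>B u w\<close> with coefficients independent of \<open>u\<close>,
  and such combinations of derivations are derivations.\<close>

lemma derivation_parameter:
  assumes E: "\<And>j. j \<in> I \<Longrightarrow> derivation R M (E j)"
    and B: "\<And>u. u \<in> carrier M \<Longrightarrow> derivation R M (B u)"
    and BE: "\<And>u j. \<lbrakk>u \<in> carrier M; j \<in> I\<rbrakk> \<Longrightarrow> B u (gen j) = E j u"
    and v: "v \<in> carrier M"
  shows "derivation R M (\<lambda>u. B u v)"
  using v
proof (induction rule: generated_induct)
  case (gen j)
  show ?case
    by (rule derivation_cong[OF E[OF gen]]) (use BE gen module ring_axioms in auto)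
next
  case one
  show ?case
    by (rule derivation_cong[OF derivation_zero])
      (use derivation_one[OF B] module ring_axioms in auto)
next
  case (add v w)
  show ?case
    by (rule derivation_cong[OF derivation_add[OF add.IH]])
      (use derivationD(2)[OF B] add.hyps module ring_axioms in auto)
next
  case (mult v w)
  show ?case
    by (rule derivation_cong[OF derivation_add[OF derivation_mult derivation_mult], OF mult.IH(1) mult.hyps(2) mult.IH(2) mult.hyps(1)])
      (use derivationD(1,4)[OF B] mult.hyps module ring_axioms in \<open>auto simp: m_comm\<close>)
next
  case (smult r v)
  show ?case
    by (rule derivation_cong[OF derivation_smult[OF smult.IH smult.hyps(1)]])
      (use derivationD(3)[OF B] smult.hyps module ring_axioms in auto)
qed

text \<open>The extensions can be chosen separately for each \<open>u\<close> without any coherence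
  between the choices: \<open>derivation_parameter\<close> shows that the result is a derivation in
  \<open>u\<close> as well.\<close>

lemma biderivation_extension:
  assumes E: "\<And>j. j \<in> I \<Longrightarrow> derivation R M (E j)"
    and gens: "\<And>i. i \<in> I \<Longrightarrow> \<exists>D. derivation R M D \<and> (\<forall>j\<in>I. D (gen j) = E j (gen i))"
  shows "\<exists>B. (\<forall>u\<in>carrier M. derivation R M (B u)) \<and>
    (\<forall>v\<in>carrier M. derivation R M (\<lambda>u. B u v)) \<and>
    (\<forall>u\<in>carrier M. \<forall>j\<in>I. B u (gen j) = E j u)"
proof -
  have "\<forall>u\<in>carrier M. \<exists>D. derivation R M D \<and> (\<forall>j\<in>I. D (gen j) = E j u)"
    using derivation_extension[OF E gens] by blast
  then obtain B where B: "\<And>u. u \<in> carrier M \<Longrightarrow> derivation R M (B u)"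
    "\<And>u j. \<lbrakk>u \<in> carrier M; j \<in> I\<rbrakk> \<Longrightarrow> B u (gen j) = E j u"
    by metis
  moreover have "derivation R M (\<lambda>u. B u v)" if "v \<in> carrier M" for v
    by (rule derivation_parameter[OF E B that])
  ultimately show ?thesis by blast
qed

text \<open>The hypothesis \<open>left\<close> supplies the family \<open>E j\<close> extending
  \<open>g i j\<close> in \<open>i\<close>; the hypothesis \<open>right\<close> then says that this
  family can be extended at each generator.\<close>

lemma biderivation_on_generators:
  assumes right: "\<And>i. i \<in> I \<Longrightarrow> \<exists>D. derivation R M D \<and> (\<forall>j\<in>I. D (gen j) = g i j)"
    and left: "\<And>j. j \<in> I \<Longrightarrow> \<exists>D. derivation R M D \<and> (\<forall>i\<in>I. D (gen i) = g i j)"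
  shows "\<exists>B. (\<forall>u\<in>carrier M. derivation R M (B u)) \<and>
    (\<forall>v\<in>carrier M. derivation R M (\<lambda>u. B u v)) \<and>
    (\<forall>i\<in>I. \<forall>j\<in>I. B (gen i) (gen j) = g i j)"
proof -
  obtain E where E: "\<And>j. j \<in> I \<Longrightarrow> derivation R M (E j)"
    "\<And>i j. \<lbrakk>i \<in> I; j \<in> I\<rbrakk> \<Longrightarrow> E j (gen i) = g i j"
    using left by metis
  have gens: "\<exists>D. derivation R M D \<and> (\<forall>j\<in>I. D (gen j) = E j (gen i))" if "i \<in> I" for i
    using right[OF that] E(2) that by simp
  have "\<exists>B. (\<forall>u\<in>carrier M. derivation R M (B u)) \<and>
      (\<forall>v\<in>carrier M. derivation R M (\<lambda>u. B u v)) \<and>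
      (\<forall>u\<in>carrier M. \<forall>j\<in>I. B u (gen j) = E j u)"
    by (rule biderivation_extension; (rule E(1) | rule gens); assumption)
  then show ?thesis by (elim ex_forward) (simp add: E(2))
qed

text \<open>The arguments are freed from the generators one after another: first two slots for each
  fixed generator in the third, then the third slot for each fixed middle argument.\<close>

lemma triderivation_on_generators:
  assumes slot3: "\<And>i j. \<lbrakk>i \<in> I; j \<in> I\<rbrakk> \<Longrightarrow> \<exists>D. derivation R M D \<and> (\<forall>k\<in>I. D (gen k) = g i j k)"
    and slot2: "\<And>i k. \<lbrakk>i \<in> I; k \<in> I\<rbrakk> \<Longrightarrow> \<exists>D. derivation R M D \<and> (\<forall>j\<in>I. D (gen j) = g i j k)"
    and slot1: "\<And>j k. \<lbrakk>j \<in> I; k \<in> I\<rbrakk> \<Longrightarrow> \<exists>D. derivation R M D \<and> (\<forall>i\<in>I. D (gen i) = g i j k)"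
  shows "\<exists>T. (\<forall>u\<in>carrier M. \<forall>v\<in>carrier M. derivation R M (T u v)) \<and>
    (\<forall>u\<in>carrier M. \<forall>w\<in>carrier M. derivation R M (\<lambda>v. T u v w)) \<and>
    (\<forall>v\<in>carrier M. \<forall>w\<in>carrier M. derivation R M (\<lambda>u. T u v w)) \<and>
    (\<forall>i\<in>I. \<forall>j\<in>I. \<forall>k\<in>I. T (gen i) (gen j) (gen k) = g i j k)"
proof -
  have "\<forall>k\<in>I. \<exists>B. (\<forall>u\<in>carrier M. derivation R M (B u)) \<and>
      (\<forall>v\<in>carrier M. derivation R M (\<lambda>u. B u v)) \<and>
      (\<forall>i\<in>I. \<forall>j\<in>I. B (gen i) (gen j) = g i j k)"
    by (rule ballI, rule biderivation_on_generators; (rule slot2 | rule slot1); assumption)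
  from bchoice[OF this] obtain G where "\<forall>k\<in>I. (\<forall>u\<in>carrier M. derivation R M (G k u)) \<and>
      (\<forall>v\<in>carrier M. derivation R M (\<lambda>u. G k u v)) \<and>
      (\<forall>i\<in>I. \<forall>j\<in>I. G k (gen i) (gen j) = g i j k)" ..
  then have G: "\<And>k u. \<lbrakk>k \<in> I; u \<in> carrier M\<rbrakk> \<Longrightarrow> derivation R M (G k u)"
      "\<And>k v. \<lbrakk>k \<in> I; v \<in> carrier M\<rbrakk> \<Longrightarrow> derivation R M (\<lambda>u. G k u v)"
      "\<And>i j k. \<lbrakk>i \<in> I; j \<in> I; k \<in> I\<rbrakk> \<Longrightarrow> G k (gen i) (gen j) = g i j k"
    by simp_all
  \<comment> \<open>Here the first argument is still a generator and the middle one becomes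
    arbitrary: at generators \<open>v\<close> the extension in the third slot comes from
    \<open>slot3\<close>, and \<open>derivation_extension\<close> carries it to all
    \<open>v\<close>.\<close>
  have gens: "\<exists>D. derivation R M D \<and> (\<forall>k\<in>I. D (gen k) = G k (gen i) v)"
    if "i \<in> I" "v \<in> carrier M" for i v
  proof (rule derivation_extension[of "\<lambda>k. G k (gen i)"])
    show "\<exists>D. derivation R M D \<and> (\<forall>k\<in>I. D (gen k) = G k (gen i) (gen j))" if "j \<in> I" for j
      using slot3[OF \<open>i \<in> I\<close> that] G(3) that \<open>i \<in> I\<close> by simp
  qed (use that G(1) in auto)
  \<comment> \<open>For fixed \<open>v\<close> the family to be extended is \<open>u\<close> mapped
    to \<open>G k u v\<close>, indexed by the generator \<open>k\<close> of the third slot.\<close>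
  have "\<forall>v\<in>carrier M. \<exists>B. (\<forall>u\<in>carrier M. derivation R M (B u)) \<and>
      (\<forall>w\<in>carrier M. derivation R M (\<lambda>u. B u w)) \<and>
      (\<forall>u\<in>carrier M. \<forall>k\<in>I. B u (gen k) = G k u v)"
    by (rule ballI, rule biderivation_extension; (rule G(2) | rule gens); assumption)
  from bchoice[OF this] obtain C where "\<forall>v\<in>carrier M. (\<forall>u\<in>carrier M. derivation R M (C v u)) \<and>
      (\<forall>w\<in>carrier M. derivation R M (\<lambda>u. C v u w)) \<and>
      (\<forall>u\<in>carrier M. \<forall>k\<in>I. C v u (gen k) = G k u v)" ..
  then have C: "\<And>v u. \<lbrakk>v \<in> carrier M; u \<in> carrier M\<rbrakk> \<Longrightarrow> derivation R M (C v u)"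
      "\<And>v w. \<lbrakk>v \<in> carrier M; w \<in> carrier M\<rbrakk> \<Longrightarrow> derivation R M (\<lambda>u. C v u w)"
      "\<And>v u k. \<lbrakk>v \<in> carrier M; u \<in> carrier M; k \<in> I\<rbrakk> \<Longrightarrow> C v u (gen k) = G k u v"
    by simp_all
  \<comment> \<open>The choice of \<open>C v\<close> for each \<open>v\<close> carries no
    information about the dependence on \<open>v\<close>. That is recovered from the third slot: at
    a generator \<open>k\<close> the value is \<open>G k u v\<close>, a derivation in
    \<open>v\<close>.\<close>
  have mid: "derivation R M (\<lambda>v. C v u w)" if "u \<in> carrier M" "w \<in> carrier M" for u w
    by (rule derivation_parameter[of "\<lambda>k. G k u" "\<lambda>v. C v u"]) (use that C G(1) in simp_all)
  show ?thesis
    by (rule exI[of _ "\<lambda>u v. C v u"]) (use C G(3) mid in simp)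
qed

end


section \<open>The trace algebra and its derivations\<close>

lemma (in abelian_monoid) finsum_swap:
  assumes "finite A" "finite B" "\<And>i j. \<lbrakk>i \<in> A; j \<in> B\<rbrakk> \<Longrightarrow> f i j \<in> carrier G"
  shows "(\<Oplus>i\<in>A. \<Oplus>j\<in>B. f i j) = (\<Oplus>j\<in>B. \<Oplus>i\<in>A. f i j)"
  using assms(1,3)
proof (induction A rule: finite_induct)
  case empty
  then show ?case by (simp add: finsum_zero)
next
  case (insert a A)
  have "(\<Oplus>i\<in>insert a A. \<Oplus>j\<in>B. f i j) = (\<Oplus>j\<in>B. f a j) \<oplus> (\<Oplus>j\<in>B. \<Oplus>i\<in>A. f i j)"
    using insert by (simp add: Pi_def)
  also have "\<dots> = (\<Oplus>j\<in>B. f a j \<oplus> (\<Oplus>i\<in>A. f i j))"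
    using insert.prems by (subst finsum_addf) (auto simp: Pi_def)
  also have "\<dots> = (\<Oplus>j\<in>B. \<Oplus>i\<in>insert a A. f i j)"
    using insert by (intro finsum_cong') (auto simp: Pi_def)
  finally show ?case .
qed

lemma (in module) submodule_Inter:
  assumes "\<And>N. N \<in> \<N> \<Longrightarrow> submodule N R M" "\<N> \<noteq> {}"
  shows "submodule (\<Inter>\<N>) R M"
proof -
  note N = submoduleE[OF assms(1)]
  have "\<zero>\<^bsub>M\<^esub> \<in> N" if "N \<in> \<N>" for N
    using subgroup.one_closed[OF submodule.axioms(1)[OF assms(1)[OF that]]] by simp
  moreover have "\<Inter>\<N> \<subseteq> carrier M"
    using assms(2) N(1) by (meson Inter_lower ex_in_conv subset_trans)
  ultimately show ?thesis
    by (intro submoduleI) (simp_all add: N(3-5))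
qed

lemma (in algebra) subalgebra_algebra:
  assumes "subring H M" "submodule H R M"
  shows "algebra R (M\<lparr>carrier := H\<rparr>)"
proof -
  interpret H: cring "M\<lparr>carrier := H\<rparr>"
    using subring_is_ring[OF assms(1)] subringE(1)[OF assms(1)]
    by (intro cring.intro comm_monoid.intro comm_monoid_axioms.intro ring.axioms(2))
       (auto simp: m_comm subset_iff)
  interpret module R "M\<lparr>carrier := H\<rparr>"
    using submodule.submodule_is_module[OF assms(2) module] .
  show ?thesis
    using subringE(1)[OF assms(1)]
    by (intro algebra.intro algebra_axioms.intro H.cring_axioms module_axioms)
       (auto simp: smult_assoc2 subset_iff)
qed

section \<open>Entries as generators of \<open>A\<^sub>n\<close> and derivations prescribed on
  them\<close>

locale algebra_trace = assoc_algebra R A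
  for R :: "('r, 'x) ring_scheme" (structure) and A :: "('r, 'a, 'y) module_scheme" (structure) +
  fixes n :: nat
begin

abbreviation "EA \<equiv> entry_algebra R A n"
abbreviation "TA \<equiv> trace_algebra R A n"
abbreviation "ent \<equiv> entry R A n"
abbreviation "tr \<equiv> Defs.trace R A n"

sublocale E: calg_presentation R "entry_gens A n" "entry_rels R A n"
  rewrites "presented_calg R (entry_gens A n) (entry_rels R A n) = entry_algebra R A n"
  by (unfold_locales) (simp add: entry_algebra_def)

sublocale E: algebra R "entry_algebra R A n"
  by (rule E.algebra_presented_calg)

lemma entry_cls: "ent x i j = E.cls (TGen (x, i, j))"
  by (simp add: entry_def E.cls_def)

lemma entry_term:
  assumes "x \<in> carrier A" "i \<in> {1..n}" "j \<in> {1..n}"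
  shows "TGen (x, i, j) \<in> calg_terms R (entry_gens A n)"
  using assms by (auto intro!: calg_terms.gen simp: entry_gens_def)

lemma entry_closed [simp, intro]:
  assumes "x \<in> carrier A" "i \<in> {1..n}" "j \<in> {1..n}"
  shows "ent x i j \<in> carrier EA"
  using entry_term[OF assms] by (simp add: entry_cls E.presented_calg_carrier)

lemma entry_linear:
  assumes ij: "i \<in> {1..n}" "j \<in> {1..n}"
  shows "(\<lambda>x. ent x i j) \<in> linear_maps R A EA"
proof (rule linear_mapsI)
  fix x y assume xy: "x \<in> carrier A" "y \<in> carrier A"
  show "ent (x \<oplus>\<^bsub>A\<^esub> y) i j = ent x i j \<oplus>\<^bsub>EA\<^esub> ent y i j"
    using E.presented_calg_rel[OF entry_rels.add[OF xy ij]] xy ij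
    by (simp add: entry_cls E.presented_calg_add entry_term calg_terms.add)
next
  fix r x assume rx: "r \<in> carrier R" "x \<in> carrier A"
  show "ent (r \<odot>\<^bsub>A\<^esub> x) i j = r \<odot>\<^bsub>EA\<^esub> ent x i j"
    using E.presented_calg_rel[OF entry_rels.smult[OF rx ij]] rx ij
    by (simp add: entry_cls E.presented_calg_smult entry_term calg_terms.smul)
qed (use ij in auto)

lemma foldr_TAdd_term:
  assumes "\<And>l. l \<in> set ls \<Longrightarrow> h l \<in> calg_terms R (entry_gens A n)"
  shows "foldr TAdd (map h ls) TZero \<in> calg_terms R (entry_gens A n)"
  using assms by (induction ls) (auto intro: calg_terms.intros)

lemma cls_foldr_TAdd:
  assumes "\<And>l. l \<in> set ls \<Longrightarrow> h l \<in> calg_terms R (entry_gens A n)" "distinct ls"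
  shows "E.cls (foldr TAdd (map h ls) TZero) = (\<Oplus>\<^bsub>EA\<^esub>l\<in>set ls. E.cls (h l))"
  using assms
proof (induction ls)
  case Nil
  then show ?case by (simp add: E.presented_calg_consts)
next
  case (Cons l ls)
  then show ?case
    by (simp add: E.presented_calg_add[symmetric] foldr_TAdd_term E.presented_calg_carrier Pi_def)
qed

lemma entry_mult:
  assumes "x \<in> carrier A" "y \<in> carrier A" "i \<in> {1..n}" "j \<in> {1..n}"
  shows "ent (x \<otimes>\<^bsub>A\<^esub> y) i j = (\<Oplus>\<^bsub>EA\<^esub>l\<in>{1..n}. ent x i l \<otimes>\<^bsub>EA\<^esub> ent y l j)"
proof -
  have t: "TMul (TGen (x, i, l)) (TGen (y, l, j)) \<in> calg_terms R (entry_gens A n)"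
    if "l \<in> {1..n}" for l
    using that assms by (intro calg_terms.mul entry_term)
  have set: "set [1..<Suc n] = {1..n}" by auto
  have "ent (x \<otimes>\<^bsub>A\<^esub> y) i j =
      E.cls (foldr TAdd (map (\<lambda>l. TMul (TGen (x, i, l)) (TGen (y, l, j))) [1..<Suc n]) TZero)"
    unfolding entry_cls using assms t set
    by (intro E.presented_calg_rel entry_rels.mult entry_term foldr_TAdd_term) auto
  also have "\<dots> = (\<Oplus>\<^bsub>EA\<^esub>l\<in>{1..n}. E.cls (TMul (TGen (x, i, l)) (TGen (y, l, j))))"
    using t by (subst cls_foldr_TAdd) (simp_all only: set distinct_upt)
  also have "\<dots> = (\<Oplus>\<^bsub>EA\<^esub>l\<in>{1..n}. ent x i l \<otimes>\<^bsub>EA\<^esub> ent y l j)"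
  proof (rule E.M.finsum_cong')
    show "E.cls (TMul (TGen (x, i, l)) (TGen (y, l, j))) = ent x i l \<otimes>\<^bsub>EA\<^esub> ent y l j"
      if "l \<in> {1..n}" for l
      using assms that by (simp only: entry_cls E.presented_calg_mult entry_term)
  qed (use assms in auto)
  finally show ?thesis .
qed

text \<open>The values \<open>(d x)\<^sub>i\<^sub>j\<close> on the generators respect the entry
  relations: additivity and scalars by linearity, the unit because \<open>d 1 = 0\<close>, and the
  matrix product by the product rule for \<open>d\<close>.\<close>

lemma entry_derivation:
  assumes d: "derivation R A d"
  obtains D where "derivation R EA D"
    and "\<And>x i j. \<lbrakk>x \<in> carrier A; i \<in> {1..n}; j \<in> {1..n}\<rbrakk> \<Longrightarrow> D (ent x i j) = ent (d x) i j"
proof -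
  define f where "f = (\<lambda>(x, i, j). ent (d x) i j)"
  note dD = derivationD[OF d]
  have td_gen: "E.term_derivative f (TGen (x, i, j)) = ent (d x) i j" for x i j
    by (simp add: f_def)
  have f_closed: "f g \<in> carrier EA" if "g \<in> entry_gens A n" for g
    using that dD(1) by (cases g) (simp add: f_def entry_gens_def)
  have td_foldr: "E.term_derivative f (foldr TAdd (map h ls) TZero) =
      (\<Oplus>\<^bsub>EA\<^esub>l\<in>set ls. E.term_derivative f (h l))"
    if "\<And>l. l \<in> set ls \<Longrightarrow> E.term_derivative f (h l) \<in> carrier EA" "distinct ls" for h and ls :: "nat list"
    using that by (induction ls) (simp_all add: Pi_def)
  have f_rel: "E.term_derivative f s = E.term_derivative f t" if "(s, t) \<in> entry_rels R A n" for s t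
    using that
  proof (cases rule: entry_rels.cases)
    case (one i j)
    \<comment> \<open>Both constants on the right of the unit relation have derivative zero, so the
      entries of \<open>d 1 = 0\<close> must vanish.\<close>
    have "ent \<zero>\<^bsub>A\<^esub> i j = \<zero>\<^bsub>EA\<^esub>"
      using linear_maps_zero[OF module_axioms E.module entry_linear] one by blast
    then show ?thesis using one derivation_one[OF d] by (simp add: f_def)
  next
    case (smult r x i j)
    then show ?thesis
      using dD linear_mapsD(3)[OF entry_linear] by (simp add: f_def)
  next
    case (add x y i j)
    then show ?thesis
      using dD linear_mapsD(2)[OF entry_linear] by (simp add: f_def)
  next
    case (mult x y i j)
    have set: "set [1..<Suc n] = {1..n}" by auto
    let ?h = "\<lambda>l. TMul (TGen (x, i, l)) (TGen (y, l, j))"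
    have td_h: "E.term_derivative f (?h l) =
        ent (d x) i l \<otimes>\<^bsub>EA\<^esub> ent y l j \<oplus>\<^bsub>EA\<^esub> ent x i l \<otimes>\<^bsub>EA\<^esub> ent (d y) l j" for l
      by (simp add: f_def entry_cls)
    have closed_h: "E.term_derivative f (?h l) \<in> carrier EA" if "l \<in> {1..n}" for l
      unfolding td_h using mult that dD(1) by (intro E.M.a_closed E.m_closed entry_closed)
    have "E.term_derivative f t = (\<Oplus>\<^bsub>EA\<^esub>l\<in>{1..n}. E.term_derivative f (?h l))"
      unfolding mult(2) by (subst td_foldr) (simp_all only: set closed_h distinct_upt)
    \<comment> \<open>Splitting the sum of termwise product rules leaves two matrix products, the
      entries of \<open>d x\<close> times \<open>y\<close> and of \<open>x\<close> times
      \<open>d y\<close>.\<close>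
    also have "\<dots> = (\<Oplus>\<^bsub>EA\<^esub>l\<in>{1..n}. ent (d x) i l \<otimes>\<^bsub>EA\<^esub> ent y l j)
        \<oplus>\<^bsub>EA\<^esub> (\<Oplus>\<^bsub>EA\<^esub>l\<in>{1..n}. ent x i l \<otimes>\<^bsub>EA\<^esub> ent (d y) l j)"
      unfolding td_h using mult dD(1) by (intro E.M.finsum_addf) auto
    also have "\<dots> = ent (d x \<otimes>\<^bsub>A\<^esub> y) i j \<oplus>\<^bsub>EA\<^esub> ent (x \<otimes>\<^bsub>A\<^esub> d y) i j"
      using mult dD(1) by (simp add: entry_mult)
    also have "\<dots> = ent (d (x \<otimes>\<^bsub>A\<^esub> y)) i j"
      using mult dD linear_mapsD(2)[OF entry_linear] by simp
    finally show ?thesis by (simp only: mult(1) td_gen)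
  qed
  obtain D where "derivation R EA D"
    "\<And>t. t \<in> calg_terms R (entry_gens A n) \<Longrightarrow> D (E.cls t) = E.term_derivative f t"
    using E.presented_calg_derivation[OF f_closed f_rel] by blast
  then show thesis
    using that entry_term by (metis entry_cls td_gen)
qed

section \<open>The trace and the subalgebra it generates\<close>

lemma trace_linear: "tr \<in> linear_maps R A EA"
proof (rule linear_mapsI)
  note lin = linear_mapsD[OF entry_linear]
  fix x assume x: "x \<in> carrier A"
  then show "tr x \<in> carrier EA"
    by (auto simp: trace_def intro!: E.M.finsum_closed)
  show "tr (x \<oplus>\<^bsub>A\<^esub> y) = tr x \<oplus>\<^bsub>EA\<^esub> tr y" if y: "y \<in> carrier A" for y
  proof -
    have "tr (x \<oplus>\<^bsub>A\<^esub> y) = (\<Oplus>\<^bsub>EA\<^esub>i\<in>{1..n}. ent x i i \<oplus>\<^bsub>EA\<^esub> ent y i i)"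
      unfolding trace_def using x y by (intro E.M.finsum_cong') (auto simp: lin)
    also have "\<dots> = tr x \<oplus>\<^bsub>EA\<^esub> tr y"
      unfolding trace_def using x y by (intro E.M.finsum_addf) auto
    finally show ?thesis .
  qed
  show "tr (r \<odot>\<^bsub>A\<^esub> x) = r \<odot>\<^bsub>EA\<^esub> tr x" if r: "r \<in> carrier R" for r
  proof -
    have "tr (r \<odot>\<^bsub>A\<^esub> x) = (\<Oplus>\<^bsub>EA\<^esub>i\<in>{1..n}. r \<odot>\<^bsub>EA\<^esub> ent x i i)"
      unfolding trace_def using x r by (intro E.M.finsum_cong') (auto simp: lin)
    also have "\<dots> = r \<odot>\<^bsub>EA\<^esub> tr x"
      unfolding trace_def using x r by (intro E.finsum_smult_ldistr[symmetric]) auto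
    finally show ?thesis .
  qed
qed

text \<open>Exchange the two summations over the indices and commute the factors, which is possible
  because \<open>A\<^sub>n\<close> is commutative.\<close>

lemma trace_mult_commute:
  assumes "x \<in> carrier A" "y \<in> carrier A"
  shows "tr (x \<otimes>\<^bsub>A\<^esub> y) = tr (y \<otimes>\<^bsub>A\<^esub> x)"
proof -
  have "tr (x \<otimes>\<^bsub>A\<^esub> y) = (\<Oplus>\<^bsub>EA\<^esub>i\<in>{1..n}. \<Oplus>\<^bsub>EA\<^esub>l\<in>{1..n}. ent x i l \<otimes>\<^bsub>EA\<^esub> ent y l i)"
    unfolding trace_def using assms
    by (intro E.M.finsum_cong') (auto simp: entry_mult intro!: E.M.finsum_closed)
  also have "\<dots> = (\<Oplus>\<^bsub>EA\<^esub>l\<in>{1..n}. \<Oplus>\<^bsub>EA\<^esub>i\<in>{1..n}. ent x i l \<otimes>\<^bsub>EA\<^esub> ent y l i)"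
    using assms by (intro E.M.finsum_swap) auto
  also have "\<dots> = (\<Oplus>\<^bsub>EA\<^esub>l\<in>{1..n}. \<Oplus>\<^bsub>EA\<^esub>i\<in>{1..n}. ent y l i \<otimes>\<^bsub>EA\<^esub> ent x i l)"
    using assms by (intro E.M.finsum_cong' E.m_comm) (auto intro!: E.M.finsum_closed)
  also have "\<dots> = tr (y \<otimes>\<^bsub>A\<^esub> x)"
    unfolding trace_def using assms
    by (intro E.M.finsum_cong'[symmetric]) (auto simp: entry_mult intro!: E.M.finsum_closed)
  finally show ?thesis .
qed

lemma subalgebra_trace_algebra:
  "subring (carrier TA) EA" "submodule (carrier TA) R EA" "tr ` carrier A \<subseteq> carrier TA"
proof -
  let ?S = "{H. (subring H EA \<and> submodule H R EA) \<and> tr ` carrier A \<subseteq> H}"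
  have carrier: "carrier TA = \<Inter>?S"
    by (simp add: trace_algebra_def hull_def)
  \<comment> \<open>The whole of \<open>A\<^sub>n\<close> belongs to the family, so the hull is an
    intersection of a nonempty family.\<close>
  have "carrier EA \<in> ?S"
    using E.carrier_is_subring E.carrier_is_submodule linear_mapsD(1)[OF trace_linear] by auto
  then have ne: "?S \<noteq> {}" by blast
  show "subring (carrier TA) EA"
    unfolding carrier using ne by (intro E.subring_Inter) blast+
  show "submodule (carrier TA) R EA"
    unfolding carrier using ne by (intro E.submodule_Inter) blast+
  show "tr ` carrier A \<subseteq> carrier TA"
    unfolding carrier by blast
qed

text \<open>A subalgebra shares the operations, so these rules move computations to
  \<open>EA\<close>; steps that have to stay in \<open>TA\<close> delete them.\<close>

lemma trace_algebra_ops [simp]: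
  "add TA = add EA" "mult TA = mult EA" "one TA = one EA" "zero TA = zero EA" "smult TA = smult EA"
  by (simp_all add: trace_algebra_def)

lemma trace_algebra_subset: "carrier TA \<subseteq> carrier EA"
  using subringE(1)[OF subalgebra_trace_algebra(1)] .

sublocale T: algebra R "trace_algebra R A n"
proof -
  have "EA\<lparr>carrier := carrier TA\<rparr> = TA"
    by (simp add: trace_algebra_def)
  with E.subalgebra_algebra[OF subalgebra_trace_algebra(1,2)] show "algebra R TA"
    by (simp only:)
qed

text \<open>The elements of \<open>TA\<close> with property \<open>Q\<close> form a subalgebra
  containing the traces, hence all of \<open>TA\<close> by minimality of the hull. Negatives and
  zero are obtained as scalar multiples.\<close>

lemma trace_algebra_induct [consumes 1, case_names tr one add mult smult]:
  assumes "u \<in> carrier TA"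
    and tr: "\<And>x. x \<in> carrier A \<Longrightarrow> Q (tr x)" and one: "Q \<one>\<^bsub>TA\<^esub>"
    and add: "\<And>u v. \<lbrakk>u \<in> carrier TA; v \<in> carrier TA; Q u; Q v\<rbrakk> \<Longrightarrow> Q (u \<oplus>\<^bsub>TA\<^esub> v)"
    and mult: "\<And>u v. \<lbrakk>u \<in> carrier TA; v \<in> carrier TA; Q u; Q v\<rbrakk> \<Longrightarrow> Q (u \<otimes>\<^bsub>TA\<^esub> v)"
    and smult: "\<And>r u. \<lbrakk>r \<in> carrier R; u \<in> carrier TA; Q u\<rbrakk> \<Longrightarrow> Q (r \<odot>\<^bsub>TA\<^esub> u)"
  shows "Q u"
proof -
  define H where "H = {u \<in> carrier TA. Q u}"
  have sub: "H \<subseteq> carrier EA"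
    using trace_algebra_subset by (auto simp: H_def)
  have smult_H: "r \<odot>\<^bsub>EA\<^esub> u \<in> H" if "r \<in> carrier R" "u \<in> H" for r u
    using that smult[of r u] T.smult_closed[of r u] by (simp add: H_def)
  have one_H: "\<one>\<^bsub>EA\<^esub> \<in> H"
    using one T.one_closed by (simp add: H_def)
  have add_H: "u \<oplus>\<^bsub>EA\<^esub> v \<in> H" if "u \<in> H" "v \<in> H" for u v
    using that add[of u v] T.M.a_closed[of u v] by (simp add: H_def)
  have mult_H: "u \<otimes>\<^bsub>EA\<^esub> v \<in> H" if "u \<in> H" "v \<in> H" for u v
    using that mult[of u v] T.m_closed[of u v] by (simp add: H_def)
  have minus_H: "\<ominus>\<^bsub>EA\<^esub> u \<in> H" if "u \<in> H" for u
    using smult_H[OF _ that, of "\<ominus>\<^bsub>R\<^esub> \<one>\<^bsub>R\<^esub>"] subsetD[OF sub that] by (simp add: E.smult_l_minus)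
  have zero_H: "\<zero>\<^bsub>EA\<^esub> \<in> H"
    using smult_H[OF _ one_H, of "\<zero>\<^bsub>R\<^esub>"] by simp
  have "subring H EA" "submodule H R EA"
    using E.subringI[OF sub one_H minus_H mult_H add_H]
      E.submoduleI[OF sub zero_H minus_H add_H smult_H] by simp_all
  moreover have "tr ` carrier A \<subseteq> H"
    using subalgebra_trace_algebra(3) tr by (auto simp: H_def)
  ultimately have "carrier TA \<subseteq> H"
    by (simp add: trace_algebra_def hull_minimal)
  then show ?thesis
    using assms(1) by (auto simp: H_def)
qed

text \<open>The derivation of \<open>A\<^sub>n\<close> induced by \<open>d\<close> maps traces to
  traces, and by the product rule it therefore maps the subalgebra that they generate into
  itself.\<close>

lemma trace_algebra_derivation:
  assumes d: "derivation R A d"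
  obtains D where "derivation R TA D" "\<And>x. x \<in> carrier A \<Longrightarrow> D (tr x) = tr (d x)"
proof -
  obtain D where D: "derivation R EA D"
    "\<And>x i j. \<lbrakk>x \<in> carrier A; i \<in> {1..n}; j \<in> {1..n}\<rbrakk> \<Longrightarrow> D (ent x i j) = ent (d x) i j"
    using entry_derivation[OF d] by blast
  have lin: "D \<in> linear_maps R EA EA"
    using D(1) by (simp add: derivation_def)
  have D_tr: "D (tr x) = tr (d x)" if "x \<in> carrier A" for x
  proof -
    have "D (tr x) = (\<Oplus>\<^bsub>EA\<^esub>i\<in>{1..n}. D (ent x i i))"
      unfolding trace_def using that
      by (intro linear_maps_finsum[OF E.module E.module lin]) auto
    also have "\<dots> = tr (d x)"
      unfolding trace_def using that D(2) derivationD(1)[OF d]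
      by (intro E.M.finsum_cong') auto
    finally show ?thesis .
  qed
  note in_E = trace_algebra_subset[THEN subsetD]
  have closed: "D u \<in> carrier TA" if "u \<in> carrier TA" for u
    using that
  proof (induction rule: trace_algebra_induct)
    case (tr x)
    then show ?case
      using D_tr derivationD(1)[OF d] subalgebra_trace_algebra(3) by auto
  next
    case one
    then show ?case
      using E.derivation_one[OF D(1)] T.M.zero_closed by simp
  next
    case (add u v)
    then show ?case
      using derivationD(2)[OF D(1)] in_E T.M.a_closed by simp
  next
    case (mult u v)
    then show ?case
      using derivationD(4)[OF D(1)] in_E T.M.a_closed T.m_closed by simp
  next
    case (smult r u)
    then show ?case
      using derivationD(3)[OF D(1)] in_E T.smult_closed by simp
  qed
  have "derivation R TA D"
    by (rule derivationI) (use closed derivationD[OF D(1)] in_E in simp_all)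
  then show thesis using D_tr that by blast
qed

end


section \<open>Braces in commutative algebras\<close>

lemma weak_derivation_cong:
  assumes "weak_derivation R A \<delta>" "\<And>X. X \<in> carrier (check_module R A) \<Longrightarrow> \<delta> X = \<delta>' X"
    and "module R (check_module R A)" "\<And>x. x \<in> carrier A \<Longrightarrow> check_proj R A x \<in> carrier (check_module R A)"
  shows "weak_derivation R A \<delta>'"
proof -
  interpret C: module R "check_module R A" by fact
  have lin: "\<delta> \<in> linear_maps R (check_module R A) (check_module R A)"
    using assms(1) by (simp add: weak_derivation_def)
  have "\<delta>' \<in> linear_maps R (check_module R A) (check_module R A)"
    using linear_mapsD[OF lin] by (intro linear_mapsI) (simp_all flip: assms(2))
  with assms(1) show ?thesis
    using assms(4) by (auto simp: weak_derivation_def simp flip: assms(2))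
qed

section \<open>The module of cosets of the commutator submodule\<close>

context assoc_algebra
begin

abbreviation "cA \<equiv> check_module R A"
abbreviation "proj \<equiv> check_proj R A"

lemma submodule_commutator: "submodule (commutator_submodule R A) R A"
  unfolding commutator_submodule_def hull_def
proof (rule submodule_Inter)
  show "{t. submodule t R A \<and> {x \<otimes>\<^bsub>A\<^esub> y \<ominus>\<^bsub>A\<^esub> y \<otimes>\<^bsub>A\<^esub> x |x y. x \<in> carrier A \<and> y \<in> carrier A} \<subseteq> t} \<noteq> {}"
    using carrier_is_submodule by (auto intro!: exI[of _ "carrier A"])
qed auto

sublocale C: abelian_subgroup "commutator_submodule R A" A
  by (rule abelian_subgroupI3[OF additive_subgroupI[OF submodule.axioms(1)[OF submodule_commutator]]
        is_abelian_group])

lemma check_carrier: "carrier cA = proj ` carrier A"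
  by (auto simp: check_module_def check_proj_def A_RCOSETS_def')

lemma check_cases:
  assumes "X \<in> carrier cA"
  obtains x where "x \<in> carrier A" "X = proj x"
  using assms unfolding check_carrier by blast

lemma check_proj_closed [simp, intro]: "x \<in> carrier A \<Longrightarrow> proj x \<in> carrier cA"
  by (simp add: check_carrier)

lemma check_proj_add:
  "\<lbrakk>x \<in> carrier A; y \<in> carrier A\<rbrakk> \<Longrightarrow> proj (x \<oplus>\<^bsub>A\<^esub> y) = proj x \<oplus>\<^bsub>cA\<^esub> proj y"
  by (simp add: check_module_def check_proj_def C.a_rcos_sum)

lemma check_proj_eqI:
  assumes "y \<in> proj x" "x \<in> carrier A"
  shows "proj y = proj x"
  using a_repr_independence[OF _ assms(2) C.a_subgroup] assms(1) by (simp add: check_proj_def)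

lemma check_proj_self: "x \<in> carrier A \<Longrightarrow> x \<in> proj x"
  using a_rcosI[OF C.zero_closed C.a_subset] by (simp add: check_proj_def)

text \<open>Scalar multiplication of a coset is a union over its elements. All members of the union
  coincide because \<open>A'\<close> is closed under scalars.\<close>

lemma check_proj_smult:
  assumes "r \<in> carrier R" "x \<in> carrier A"
  shows "proj (r \<odot>\<^bsub>A\<^esub> x) = r \<odot>\<^bsub>cA\<^esub> proj x"
proof -
  have "proj (r \<odot>\<^bsub>A\<^esub> y) = proj (r \<odot>\<^bsub>A\<^esub> x)" if y: "y \<in> proj x" for y
  proof (rule check_proj_eqI)
    obtain c where c: "c \<in> commutator_submodule R A" "y = c \<oplus>\<^bsub>A\<^esub> x"
      using y by (auto simp: check_proj_def a_r_coset_def')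
    have "c \<in> carrier A" using c(1) C.a_subset by blast
    then have "r \<odot>\<^bsub>A\<^esub> y = r \<odot>\<^bsub>A\<^esub> c \<oplus>\<^bsub>A\<^esub> r \<odot>\<^bsub>A\<^esub> x"
      using assms by (simp add: c(2) smult_r_distr)
    moreover have "r \<odot>\<^bsub>A\<^esub> c \<in> commutator_submodule R A"
      using submodule.smult_closed[OF submodule_commutator assms(1) c(1)] .
    ultimately show "r \<odot>\<^bsub>A\<^esub> y \<in> proj (r \<odot>\<^bsub>A\<^esub> x)"
      using assms by (simp add: check_proj_def a_rcosI C.a_subset)
  qed (use assms in simp)
  then have "(\<Union>y\<in>proj x. proj (r \<odot>\<^bsub>A\<^esub> y)) = proj (r \<odot>\<^bsub>A\<^esub> x)"
    by (intro UN_constant_eq[OF check_proj_self[OF assms(2)]] ballI)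
  then show ?thesis by (simp add: check_module_def)
qed

lemma check_zero: "\<zero>\<^bsub>cA\<^esub> = proj \<zero>\<^bsub>A\<^esub>"
  by (simp add: check_module_def check_proj_def C.a_subset)

lemma module_check: "module R cA"
proof -
  note ops = check_proj_add[symmetric] check_proj_smult[symmetric] check_zero
  have "abelian_group cA"
  proof (rule abelian_groupI)
    fix X assume "X \<in> carrier cA"
    then obtain x where x: "x \<in> carrier A" "X = proj x"
      by (rule check_cases)
    then show "\<exists>Y\<in>carrier cA. Y \<oplus>\<^bsub>cA\<^esub> X = \<zero>\<^bsub>cA\<^esub>"
      by (intro bexI[of _ "proj (\<ominus>\<^bsub>A\<^esub> x)"]) (simp_all add: ops M.l_neg)
  qed (auto elim!: check_cases simp: ops M.a_ac)
  then show ?thesis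
    by (rule moduleI[OF R.cring_axioms])
      (auto elim!: check_cases simp: ops smult_l_distr smult_r_distr smult_assoc1)
qed

lemma check_proj_linear: "proj \<in> linear_maps R A cA"
  by (intro linear_mapsI) (simp_all add: check_proj_add check_proj_smult)

end

section \<open>Brackets of arity two and three as functions on lists\<close>

lemma tuples_2: "xs \<in> tuples M 2 \<longleftrightarrow> (\<exists>a b. xs = [a, b] \<and> a \<in> carrier M \<and> b \<in> carrier M)"
  by (auto simp: tuples_def numeral_2_eq_2 length_Suc_conv)

lemma tuples_3:
  "xs \<in> tuples M 3 \<longleftrightarrow> (\<exists>a b c. xs = [a, b, c] \<and> a \<in> carrier M \<and> b \<in> carrier M \<and> c \<in> carrier M)"
  by (auto simp: tuples_def numeral_3_eq_3 length_Suc_conv)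

lemma less_3_iff: "i < (3::nat) \<longleftrightarrow> i = 0 \<or> i = 1 \<or> i = 2"
  by auto

lemma multi_derivation_2:
  assumes "\<And>v. v \<in> carrier M \<Longrightarrow> derivation R M (\<lambda>u. B u v)"
    and "\<And>u. u \<in> carrier M \<Longrightarrow> derivation R M (\<lambda>v. B u v)"
  shows "multi_derivation R M 2 (\<lambda>xs. B (xs ! 0) (xs ! 1))"
  unfolding multi_derivation_def using assms by (auto simp: tuples_2 less_2_cases_iff)

lemma multi_derivation_3:
  assumes "\<And>v w. \<lbrakk>v \<in> carrier M; w \<in> carrier M\<rbrakk> \<Longrightarrow> derivation R M (\<lambda>u. T u v w)"
    and "\<And>u w. \<lbrakk>u \<in> carrier M; w \<in> carrier M\<rbrakk> \<Longrightarrow> derivation R M (\<lambda>v. T u v w)"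
    and "\<And>u v. \<lbrakk>u \<in> carrier M; v \<in> carrier M\<rbrakk> \<Longrightarrow> derivation R M (\<lambda>w. T u v w)"
  shows "multi_derivation R M 3 (\<lambda>xs. T (xs ! 0) (xs ! 1) (xs ! 2))"
  unfolding multi_derivation_def using assms by (auto simp: tuples_3 less_3_iff)

text \<open>Closedness is read off slot 0, by updating it with the entry already there. For
  \<open>m = 0\<close> there is no slot and the definition would say nothing about the value at the
  empty list.\<close>

lemma multi_derivation_closed:
  assumes "multi_derivation R M m f" "m > 0" "xs \<in> tuples M m"
  shows "f xs \<in> carrier M"
proof -
  have "derivation R M (\<lambda>x. f (xs[0 := x]))"
    using assms by (auto simp: multi_derivation_def)
  moreover have "xs ! 0 \<in> carrier M"
    using assms(2,3) by (auto simp: tuples_def)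
  ultimately have "f (xs[0 := xs ! 0]) \<in> carrier M"
    by (rule derivationD(1))
  then show ?thesis by simp
qed

text \<open>The bracket on \<open>M / M'\<close> that corresponds to \<open>f\<close> when \<open>M\<close> is commutative.\<close>

definition singleton_bracket ::
  "('r, 'x) ring_scheme \<Rightarrow> ('r, 'a, 'y) module_scheme \<Rightarrow> nat \<Rightarrow> ('a list \<Rightarrow> 'a) \<Rightarrow> 'a set list \<Rightarrow> 'a set"
  where "singleton_bracket R M m f =
    restrict (\<lambda>Xs. {f (map the_elem Xs)}) (tuples (check_module R M) m)"

section \<open>Commutative algebras: cosets are singletons and weak derivations are
  derivations\<close>

context algebra
begin

interpretation as: assoc_algebra R M by (rule assoc_algebra)

lemma commutator_submodule_trivial: "commutator_submodule R M = {\<zero>\<^bsub>M\<^esub>}"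
proof
  show "commutator_submodule R M \<subseteq> {\<zero>\<^bsub>M\<^esub>}"
    unfolding commutator_submodule_def
  proof (rule hull_minimal)
    show "{x \<otimes>\<^bsub>M\<^esub> y \<ominus>\<^bsub>M\<^esub> y \<otimes>\<^bsub>M\<^esub> x |x y. x \<in> carrier M \<and> y \<in> carrier M} \<subseteq> {\<zero>\<^bsub>M\<^esub>}"
      by (auto simp: m_comm M.r_neg a_minus_def)
    show "submodule {\<zero>\<^bsub>M\<^esub>} R M"
      by (rule submoduleI) auto
  qed
qed (use as.C.zero_closed in simp)

lemma check_proj_singleton: "x \<in> carrier M \<Longrightarrow> check_proj R M x = {x}"
  by (simp add: check_proj_def commutator_submodule_trivial a_r_coset_def')

lemma check_carrier_singletons: "carrier (check_module R M) = (\<lambda>x. {x}) ` carrier M"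
  by (auto simp: as.check_carrier check_proj_singleton)

lemma check_singleton_cases:
  assumes "X \<in> carrier (check_module R M)"
  obtains x where "x \<in> carrier M" "X = {x}"
  using assms unfolding check_carrier_singletons by blast

lemma check_singleton_ops:
  "\<lbrakk>x \<in> carrier M; y \<in> carrier M\<rbrakk> \<Longrightarrow> {x} \<oplus>\<^bsub>check_module R M\<^esub> {y} = {x \<oplus>\<^bsub>M\<^esub> y}"
  "\<lbrakk>r \<in> carrier R; x \<in> carrier M\<rbrakk> \<Longrightarrow> r \<odot>\<^bsub>check_module R M\<^esub> {x} = {r \<odot>\<^bsub>M\<^esub> x}"
  "x \<in> carrier M \<Longrightarrow> \<ominus>\<^bsub>check_module R M\<^esub> {x} = {\<ominus>\<^bsub>M\<^esub> x}"
  using as.check_proj_add[of x y] as.check_proj_smult[of r x]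
    linear_maps_minus[OF module as.module_check as.check_proj_linear, of x]
  by (simp_all add: check_proj_singleton)

lemma weak_derivation_singleton:
  assumes "derivation R M d"
  shows "weak_derivation R M (\<lambda>X. {d (the_elem X)})"
  unfolding weak_derivation_def
proof (intro conjI exI[of _ d] ballI)
  show "(\<lambda>X. {d (the_elem X)}) \<in> linear_maps R (check_module R M) (check_module R M)"
  proof (rule linear_mapsI)
    fix X assume X: "X \<in> carrier (check_module R M)"
    then obtain x where x: "x \<in> carrier M" "X = {x}"
      by (rule check_singleton_cases)
    then show "{d (the_elem X)} \<in> carrier (check_module R M)"
      using derivationD(1)[OF assms x(1)] by (simp add: check_carrier_singletons)
    show "{d (the_elem (r \<odot>\<^bsub>check_module R M\<^esub> X))} = r \<odot>\<^bsub>check_module R M\<^esub> {d (the_elem X)}"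
      if "r \<in> carrier R" for r
      using derivationD(1)[OF assms x(1)] derivationD(3)[OF assms that x(1)] x that
      by (simp add: check_singleton_ops)
    fix Y assume "Y \<in> carrier (check_module R M)"
    then obtain y where y: "y \<in> carrier M" "Y = {y}"
      by (rule check_singleton_cases)
    show "{d (the_elem (X \<oplus>\<^bsub>check_module R M\<^esub> Y))} =
        {d (the_elem X)} \<oplus>\<^bsub>check_module R M\<^esub> {d (the_elem Y)}"
      using derivationD(1)[OF assms x(1)] derivationD(1)[OF assms y(1)]
        derivationD(2)[OF assms x(1) y(1)] x y
      by (simp add: check_singleton_ops)
  qed
  show "derivation R M d" by fact
  show "{d (the_elem (check_proj R M x))} = check_proj R M (d x)" if "x \<in> carrier M" for x
    using derivationD(1)[OF assms that] that by (simp add: check_proj_singleton)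
qed

text \<open>The map agrees on the carrier with any derivation that induces \<open>\<delta>\<close>,
  since the cosets are singletons.\<close>

lemma derivation_the_elem:
  assumes "weak_derivation R M \<delta>"
  shows "derivation R M (\<lambda>x. the_elem (\<delta> {x}))"
proof -
  obtain d where d: "derivation R M d" "\<And>x. x \<in> carrier M \<Longrightarrow> \<delta> (check_proj R M x) = check_proj R M (d x)"
    using assms unfolding weak_derivation_def by blast
  show ?thesis
    by (rule derivation_cong[OF d(1) ring_axioms module])
      (use d(2) derivationD(1)[OF d(1)] in \<open>simp add: check_proj_singleton\<close>)
qed

lemma tuples_check:
  "Xs \<in> tuples (check_module R M) m \<longleftrightarrow> (\<exists>xs\<in>tuples M m. Xs = map (\<lambda>x. {x}) xs)"
proof
  assume Xs: "Xs \<in> tuples (check_module R M) m"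
  then have "map (\<lambda>x. {x}) (map the_elem Xs) = Xs"
    by (auto simp: tuples_def check_carrier_singletons intro!: map_idI)
  moreover have "map the_elem Xs \<in> tuples M m"
    using Xs by (auto simp: tuples_def check_carrier_singletons)
  ultimately show "\<exists>xs\<in>tuples M m. Xs = map (\<lambda>x. {x}) xs"
    by metis
qed (auto simp: tuples_def check_carrier_singletons image_iff subset_iff)

lemma singleton_bracket_apply:
  "xs \<in> tuples M m \<Longrightarrow> singleton_bracket R M m f (map (\<lambda>x. {x}) xs) = {f xs}"
  by (auto simp: singleton_bracket_def tuples_check comp_def)

text \<open>Together with \<open>brace_multi_derivation\<close> this translates between braces in a
  commutative algebra and maps that are derivations in each slot.\<close>

lemma brace_singleton_bracket:
  assumes f: "multi_derivation R M m f" and "m > 0"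
  shows "brace_in R M m (singleton_bracket R M m f)"
proof -
  let ?\<mu> = "singleton_bracket R M m f"
  have weak: "weak_derivation R M (\<lambda>X. ?\<mu> (Xs[i := X]))"
    if Xs: "Xs \<in> tuples (check_module R M) m" and i: "i < m" for Xs i
  proof -
    obtain xs where xs: "xs \<in> tuples M m" "Xs = map (\<lambda>x. {x}) xs"
      using Xs tuples_check by auto
    show ?thesis
    proof (rule weak_derivation_cong)
      show "weak_derivation R M (\<lambda>X. {f (xs[i := the_elem X])})"
        using f xs(1) i by (intro weak_derivation_singleton) (simp add: multi_derivation_def)
      fix X assume "X \<in> carrier (check_module R M)"
      then obtain x where x: "x \<in> carrier M" "X = {x}"
        by (auto simp: check_carrier_singletons)
      have "xs[i := x] \<in> tuples M m"
        using xs(1) x(1) set_update_subset_insert[of xs i x] by (auto simp: tuples_def)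
      from singleton_bracket_apply[OF this]
      show "{f (xs[i := the_elem X])} = ?\<mu> (Xs[i := X])"
        by (simp add: x xs(2) map_update)
    qed (rule as.module_check, rule as.check_proj_closed)
  qed
  have "?\<mu> \<in> tuples (check_module R M) m \<rightarrow>\<^sub>E carrier (check_module R M)"
  proof
    fix Xs assume "Xs \<in> tuples (check_module R M) m"
    then obtain xs where xs: "xs \<in> tuples M m" "Xs = map (\<lambda>x. {x}) xs"
      using tuples_check by auto
    then show "?\<mu> Xs \<in> carrier (check_module R M)"
      using multi_derivation_closed[OF f \<open>m > 0\<close> xs(1)]
      by (simp add: singleton_bracket_apply check_carrier_singletons)
  qed (simp add: singleton_bracket_def)
  with weak show ?thesis
    by (auto simp: brace_in_def bracket_in_def weak_derivation_def)
qed

lemma brace_multi_derivation: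
  assumes "brace_in R M m \<mu>"
  shows "multi_derivation R M m (\<lambda>xs. the_elem (\<mu> (map (\<lambda>x. {x}) xs)))"
  unfolding multi_derivation_def
proof (intro ballI allI impI)
  fix xs i assume xs: "xs \<in> tuples M m" and i: "i < m"
  have "weak_derivation R M (\<lambda>X. \<mu> ((map (\<lambda>x. {x}) xs)[i := X]))"
    using assms xs i by (auto simp: brace_in_def tuples_check)
  from derivation_the_elem[OF this]
  show "derivation R M (\<lambda>x. the_elem (\<mu> (map (\<lambda>x. {x}) (xs[i := x]))))"
    by (simp add: map_update)
qed

end

text \<open>Off the tuples both braces are undefined. On tuples their values are singletons, whose
  elements are multi-derivations in the entries and hence determined by the generators.\<close>

lemma (in generated_algebra) brace_eqI:
  assumes \<mu>: "brace_in R M m \<mu>" and \<nu>: "brace_in R M m \<nu>"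
    and eq: "\<And>is. \<lbrakk>length is = m; set is \<subseteq> I\<rbrakk> \<Longrightarrow>
      \<mu> (map (\<lambda>i. {gen i}) is) = \<nu> (map (\<lambda>i. {gen i}) is)"
  shows "\<mu> = \<nu>"
proof (rule extensionalityI)
  let ?T = "tuples (check_module R M) m"
  have PiE: "\<mu> \<in> ?T \<rightarrow>\<^sub>E carrier (check_module R M)" "\<nu> \<in> ?T \<rightarrow>\<^sub>E carrier (check_module R M)"
    using \<mu> \<nu> by (auto simp: brace_in_def bracket_in_def)
  then show "\<mu> \<in> extensional ?T" "\<nu> \<in> extensional ?T"
    by (auto simp: PiE_def)
  fix Xs assume Xs: "Xs \<in> ?T"
  then obtain xs where xs: "xs \<in> tuples M m" "Xs = map (\<lambda>x. {x}) xs"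
    using tuples_check by auto
  have "the_elem (\<mu> (map (\<lambda>x. {x}) xs)) = the_elem (\<nu> (map (\<lambda>x. {x}) xs))"
  proof (rule multi_derivation_eqI[OF brace_multi_derivation[OF \<mu>] brace_multi_derivation[OF \<nu>] _ xs(1)])
    fix "is" :: "'i list" assume "length is = m" "set is \<subseteq> I"
    then show "the_elem (\<mu> (map (\<lambda>x. {x}) (map gen is))) = the_elem (\<nu> (map (\<lambda>x. {x}) (map gen is)))"
      using eq[of "is"] by (simp add: comp_def)
  qed
  moreover have "\<mu> Xs \<in> carrier (check_module R M)" "\<nu> Xs \<in> carrier (check_module R M)"
    using PiE Xs by (auto simp: PiE_def)
  ultimately show "\<mu> Xs = \<nu> Xs"
    by (auto simp: xs(2) check_carrier_singletons)
qed


section \<open>The induced quasi-Poisson structure\<close>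

context algebra_trace
begin

abbreviation "itr \<equiv> induced_trace R A n"

text \<open>The kernel of the trace is a submodule that contains every commutator, so it contains
  their hull.\<close>

lemma trace_commutator_submodule:
  assumes "c \<in> commutator_submodule R A"
  shows "tr c = \<zero>\<^bsub>EA\<^esub>"
proof -
  let ?K = "{x \<in> carrier A. tr x = \<zero>\<^bsub>EA\<^esub>}"
  note lin = linear_mapsD[OF trace_linear]
  note zero = linear_maps_zero[OF module_axioms E.module trace_linear]
  note minus = linear_maps_minus[OF module_axioms E.module trace_linear]
  have "submodule ?K R A"
    by (rule submoduleI) (simp_all add: lin zero minus subset_iff)
  moreover have "{x \<otimes>\<^bsub>A\<^esub> y \<ominus>\<^bsub>A\<^esub> y \<otimes>\<^bsub>A\<^esub> x |x y. x \<in> carrier A \<and> y \<in> carrier A} \<subseteq> ?K"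
  proof clarify
    fix x y assume "x \<in> carrier A" "y \<in> carrier A"
    then show "x \<otimes>\<^bsub>A\<^esub> y \<ominus>\<^bsub>A\<^esub> y \<otimes>\<^bsub>A\<^esub> x \<in> carrier A \<and> tr (x \<otimes>\<^bsub>A\<^esub> y \<ominus>\<^bsub>A\<^esub> y \<otimes>\<^bsub>A\<^esub> x) = \<zero>\<^bsub>EA\<^esub>"
      using trace_mult_commute[of x y] by (simp add: a_minus_def lin minus E.M.r_neg)
  qed
  ultimately have "commutator_submodule R A \<subseteq> ?K"
    unfolding commutator_submodule_def by (intro hull_minimal)
  then show ?thesis
    using assms by auto
qed

lemma induced_trace_proj:
  assumes "x \<in> carrier A"
  shows "itr (proj x) = tr x"
proof -
  have "tr y = tr x" if y: "y \<in> proj x" for y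
  proof -
    obtain c where c: "c \<in> commutator_submodule R A" "y = c \<oplus>\<^bsub>A\<^esub> x"
      using y by (auto simp: check_proj_def a_r_coset_def')
    have "c \<in> carrier A"
      using c(1) C.a_subset by blast
    then have "tr y = tr c \<oplus>\<^bsub>EA\<^esub> tr x"
      using linear_mapsD(2)[OF trace_linear _ assms] c(2) by simp
    then show ?thesis
      using linear_mapsD(1)[OF trace_linear assms] trace_commutator_submodule[OF c(1)] by simp
  qed
  then have "tr ` proj x \<subseteq> {tr x}"
    by blast
  then have "tr ` proj x = {tr x}"
    using check_proj_self[OF assms] by blast
  then show ?thesis
    by (simp add: induced_trace_def)
qed

lemma trace_closed: "x \<in> carrier A \<Longrightarrow> tr x \<in> carrier TA"
  using subalgebra_trace_algebra(3) by (rule subsetD) simp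

lemma induced_trace_linear: "itr \<in> linear_maps R cA TA"
proof (rule linear_mapsI)
  fix X assume "X \<in> carrier cA"
  then obtain x where x: "x \<in> carrier A" "X = proj x" by (rule check_cases)
  then show "itr X \<in> carrier TA"
    by (simp add: induced_trace_proj trace_closed)
  show "itr (r \<odot>\<^bsub>cA\<^esub> X) = r \<odot>\<^bsub>TA\<^esub> itr X" if "r \<in> carrier R" for r
    using x that linear_mapsD(3)[OF trace_linear that x(1)]
    by (simp add: check_proj_smult[symmetric] induced_trace_proj)
  fix Y assume "Y \<in> carrier cA"
  then obtain y where y: "y \<in> carrier A" "Y = proj y" by (rule check_cases)
  show "itr (X \<oplus>\<^bsub>cA\<^esub> Y) = itr X \<oplus>\<^bsub>TA\<^esub> itr Y"
    using x y linear_mapsD(2)[OF trace_linear x(1) y(1)]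
    by (simp add: check_proj_add[symmetric] induced_trace_proj)
qed

text \<open>The index set is \<open>A / A'\<close> and not \<open>A\<close>, because the values to
  be prescribed on generators, such as \<open>itr (\<beta> [X, Y])\<close>, are functions of
  classes.\<close>

sublocale G: generated_algebra R "trace_algebra R A n" "induced_trace R A n" "carrier (check_module R A)"
proof
  show "itr X \<in> carrier TA" if "X \<in> carrier cA" for X
    using linear_mapsD(1)[OF induced_trace_linear that] .
  fix u and Q :: "('r, 'a) entry_class \<Rightarrow> bool"
  assume u: "u \<in> carrier TA" and gen: "\<And>X. X \<in> carrier cA \<Longrightarrow> Q (itr X)"
    and rest: "Q \<one>\<^bsub>TA\<^esub>"
        "\<And>u v. \<lbrakk>u \<in> carrier TA; v \<in> carrier TA; Q u; Q v\<rbrakk> \<Longrightarrow> Q (u \<oplus>\<^bsub>TA\<^esub> v)"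
        "\<And>u v. \<lbrakk>u \<in> carrier TA; v \<in> carrier TA; Q u; Q v\<rbrakk> \<Longrightarrow> Q (u \<otimes>\<^bsub>TA\<^esub> v)"
        "\<And>r u. \<lbrakk>r \<in> carrier R; u \<in> carrier TA; Q u\<rbrakk> \<Longrightarrow> Q (r \<odot>\<^bsub>TA\<^esub> u)"
  have "Q (tr x)" if "x \<in> carrier A" for x
    using gen[of "proj x"] that by (simp add: induced_trace_proj)
  from u this rest show "Q u"
    by (rule trace_algebra_induct)
qed

text \<open>This supplies the one-slot extensions needed for constructing brackets from values on
  generators: it will be applied to each slot of a brace in \<open>A\<close>.\<close>

lemma weak_derivation_trace_algebra:
  assumes "weak_derivation R A \<delta>"
  shows "\<exists>D. derivation R TA D \<and> (\<forall>X\<in>carrier cA. D (itr X) = itr (\<delta> X))"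
proof -
  obtain d where d: "derivation R A d" "\<And>x. x \<in> carrier A \<Longrightarrow> \<delta> (proj x) = proj (d x)"
    using assms unfolding weak_derivation_def by blast
  obtain D where D: "derivation R TA D" "\<And>x. x \<in> carrier A \<Longrightarrow> D (tr x) = tr (d x)"
    using trace_algebra_derivation[OF d(1)] by blast
  have "D (itr X) = itr (\<delta> X)" if X: "X \<in> carrier cA" for X
  proof -
    obtain x where x: "x \<in> carrier A" "X = proj x" using X by (rule check_cases)
    then show ?thesis
      using d(2)[OF x(1)] D(2)[OF x(1)] derivationD(1)[OF d(1) x(1)]
      by (simp add: induced_trace_proj)
  qed
  with D(1) show ?thesis by blast
qed

abbreviation "check_tr \<equiv> (\<lambda>X. check_proj R TA (itr X))"

lemma check_tr_eq: "X \<in> carrier cA \<Longrightarrow> check_tr X = {itr X}"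
  using T.check_proj_singleton linear_mapsD(1)[OF induced_trace_linear] by simp

section \<open>Existence and uniqueness of the brackets on the trace algebra\<close>

context
  fixes \<beta> \<tau> :: "'a set list \<Rightarrow> 'a set"
  assumes qP: "quasi_Poisson_algebra R A \<beta> \<tau>"
begin

lemma brace_2: "brace_in R A 2 \<beta>" and brace_3: "brace_in R A 3 \<tau>"
  and quasi_Lie: "quasi_Lie_pair R cA \<beta> \<tau>"
  using qP by (simp_all add: quasi_Poisson_algebra_def)

lemma bracket_2_closed:
  assumes "X \<in> carrier cA" "Y \<in> carrier cA"
  shows "\<beta> [X, Y] \<in> carrier cA"
proof -
  have "\<beta> \<in> tuples cA 2 \<rightarrow>\<^sub>E carrier cA"
    using brace_2 by (simp add: brace_in_def bracket_in_def)
  then show ?thesis by (rule PiE_mem) (simp add: tuples_2 assms)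
qed

lemma bracket_3_closed:
  assumes "X \<in> carrier cA" "Y \<in> carrier cA" "Z \<in> carrier cA"
  shows "\<tau> [X, Y, Z] \<in> carrier cA"
proof -
  have "\<tau> \<in> tuples cA 3 \<rightarrow>\<^sub>E carrier cA"
    using brace_3 by (simp add: brace_in_def bracket_in_def)
  then show ?thesis by (rule PiE_mem) (simp add: tuples_3 assms)
qed

lemma brace_2_slots:
  assumes "X \<in> carrier cA"
  shows "weak_derivation R A (\<lambda>Y. \<beta> [X, Y])" "weak_derivation R A (\<lambda>Y. \<beta> [Y, X])"
proof -
  \<comment> \<open>The second \<open>X\<close> is a filler for the slot that gets
    overwritten.\<close>
  have t: "[X, X] \<in> tuples cA 2"
    using assms by (simp add: tuples_2)
  have "weak_derivation R A (\<lambda>Y. \<beta> ([X, X][i := Y]))" if "i < 2" for i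
    using brace_2 t that unfolding brace_in_def by blast
  from this[of 1] this[of 0]
  show "weak_derivation R A (\<lambda>Y. \<beta> [X, Y])" "weak_derivation R A (\<lambda>Y. \<beta> [Y, X])"
    by simp_all
qed

lemma brace_3_slots:
  assumes "X \<in> carrier cA" "Y \<in> carrier cA"
  shows "weak_derivation R A (\<lambda>Z. \<tau> [X, Y, Z])" "weak_derivation R A (\<lambda>Z. \<tau> [X, Z, Y])"
    "weak_derivation R A (\<lambda>Z. \<tau> [Z, X, Y])"
proof -
  have slot: "weak_derivation R A (\<lambda>W. \<tau> ([U, V, Z][i := W]))"
    if "i < 3" "U \<in> carrier cA" "V \<in> carrier cA" "Z \<in> carrier cA" for i U V Z
  proof -
    have "[U, V, Z] \<in> tuples cA 3"
      using that by (simp add: tuples_3)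
    then show ?thesis
      using brace_3 that(1) unfolding brace_in_def by blast
  qed
  from slot[of 2 X Y Y] slot[of 1 X Y Y] slot[of 0 X X Y] assms
  show "weak_derivation R A (\<lambda>Z. \<tau> [X, Y, Z])" "weak_derivation R A (\<lambda>Z. \<tau> [X, Z, Y])"
    "weak_derivation R A (\<lambda>Z. \<tau> [Z, X, Y])"
    by (simp_all add: numeral_2_eq_2)
qed

lemma trace_quasi_Poisson_exists:
  "\<exists>\<beta>' \<tau>'. quasi_Poisson_algebra R TA \<beta>' \<tau>' \<and> quasi_Poisson_hom R A \<beta> \<tau> TA \<beta>' \<tau>' check_tr"
proof -
  note itr_closed = linear_mapsD(1)[OF induced_trace_linear]
  note itr_add = linear_mapsD(2)[OF induced_trace_linear]
  note itr_minus = linear_maps_minus[OF module_check T.module induced_trace_linear]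
  interpret cA: module R cA by (rule module_check)
  \<comment> \<open>The values \<open>itr (\<beta> [X, Y])\<close> extend in each variable
    separately, as \<open>\<beta>\<close> is a weak derivation there.\<close>
  have "\<exists>B. (\<forall>u\<in>carrier TA. derivation R TA (B u)) \<and>
      (\<forall>v\<in>carrier TA. derivation R TA (\<lambda>u. B u v)) \<and>
      (\<forall>X\<in>carrier cA. \<forall>Y\<in>carrier cA. B (itr X) (itr Y) = itr (\<beta> [X, Y]))"
    by (rule G.biderivation_on_generators; rule weak_derivation_trace_algebra,
        rule brace_2_slots; assumption)
  then obtain B where Br: "\<forall>u\<in>carrier TA. derivation R TA (B u)"
    and Bl: "\<forall>v\<in>carrier TA. derivation R TA (\<lambda>u. B u v)"
    and B: "\<forall>X\<in>carrier cA. \<forall>Y\<in>carrier cA. B (itr X) (itr Y) = itr (\<beta> [X, Y])"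
    by (elim exE conjE)
  note Br = Br[rule_format] and Bl = Bl[rule_format] and B = B[rule_format]
  have "\<exists>T. (\<forall>u\<in>carrier TA. \<forall>v\<in>carrier TA. derivation R TA (T u v)) \<and>
      (\<forall>u\<in>carrier TA. \<forall>w\<in>carrier TA. derivation R TA (\<lambda>v. T u v w)) \<and>
      (\<forall>v\<in>carrier TA. \<forall>w\<in>carrier TA. derivation R TA (\<lambda>u. T u v w)) \<and>
      (\<forall>X\<in>carrier cA. \<forall>Y\<in>carrier cA. \<forall>Z\<in>carrier cA.
        T (itr X) (itr Y) (itr Z) = itr (\<tau> [X, Y, Z]))"
    by (rule G.triderivation_on_generators; rule weak_derivation_trace_algebra,
        rule brace_3_slots; assumption)
  then obtain T where T3: "\<forall>u\<in>carrier TA. \<forall>v\<in>carrier TA. derivation R TA (T u v)"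
    and T2: "\<forall>u\<in>carrier TA. \<forall>w\<in>carrier TA. derivation R TA (\<lambda>v. T u v w)"
    and T1: "\<forall>v\<in>carrier TA. \<forall>w\<in>carrier TA. derivation R TA (\<lambda>u. T u v w)"
    and T: "\<forall>X\<in>carrier cA. \<forall>Y\<in>carrier cA. \<forall>Z\<in>carrier cA.
      T (itr X) (itr Y) (itr Z) = itr (\<tau> [X, Y, Z])"
    by (elim exE conjE)
  note T3 = T3[rule_format] and T2 = T2[rule_format] and T1 = T1[rule_format]
    and T = T[rule_format]
  have B_closed: "B u v \<in> carrier TA" if "u \<in> carrier TA" "v \<in> carrier TA" for u v
    using derivationD(1)[OF Br[OF that(1)] that(2)] .
  have T_closed: "T u v w \<in> carrier TA"
    if "u \<in> carrier TA" "v \<in> carrier TA" "w \<in> carrier TA" for u v w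
    using derivationD(1)[OF T3[OF that(1,2)] that(3)] .
  have mB: "multi_derivation R TA 2 (\<lambda>xs. B (xs ! 0) (xs ! 1))"
    by (rule multi_derivation_2[OF Bl Br])
  have mT: "multi_derivation R TA 3 (\<lambda>xs. T (xs ! 0) (xs ! 1) (xs ! 2))"
    by (rule multi_derivation_3[OF T1 T2 T3])

  \<comment> \<open>As for the other identities below, both sides are derivations in each variable,
    so a comparison on traces suffices, and there the identity is the image under \<open>itr\<close>
    of the one in \<open>A\<close>.\<close>
  have skew: "B u v = \<ominus>\<^bsub>TA\<^esub> B v u" if uv: "u \<in> carrier TA" "v \<in> carrier TA" for u v
  proof -
    have m: "multi_derivation R TA 2 (\<lambda>xs. \<ominus>\<^bsub>TA\<^esub> B (xs ! 1) (xs ! 0))"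
      by (rule multi_derivation_2[of _ _ "\<lambda>x y. \<ominus>\<^bsub>TA\<^esub> B y x"]; rule T.derivation_minus; (rule Bl | rule Br))
    have "(\<lambda>xs. B (xs ! 0) (xs ! 1)) [u, v] = (\<lambda>xs. \<ominus>\<^bsub>TA\<^esub> B (xs ! 1) (xs ! 0)) [u, v]"
    proof (rule G.multi_derivation_eqI[OF mB m])
      fix Xs assume "length Xs = 2" "set Xs \<subseteq> carrier cA"
      then obtain X Y where X: "Xs = [X, Y]" "X \<in> carrier cA" "Y \<in> carrier cA"
        using tuples_2[of Xs cA] by (auto simp: tuples_def)
      have "\<beta> [X, Y] = \<ominus>\<^bsub>cA\<^esub> \<beta> [Y, X]"
        using quasi_Lie X(2,3) unfolding quasi_Lie_pair_def skew_symmetric_def by blast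
      then show "B (map itr Xs ! 0) (map itr Xs ! 1) = \<ominus>\<^bsub>TA\<^esub> B (map itr Xs ! 1) (map itr Xs ! 0)"
        using X by (simp add: B itr_minus bracket_2_closed)
    qed (use uv in \<open>simp add: tuples_2\<close>)
    then show ?thesis by simp
  qed

  have cyclic: "T u v w = T w u v"
    if uvw: "u \<in> carrier TA" "v \<in> carrier TA" "w \<in> carrier TA" for u v w
  proof -
    have m: "multi_derivation R TA 3 (\<lambda>xs. T (xs ! 2) (xs ! 0) (xs ! 1))"
      by (rule multi_derivation_3[of _ _ "\<lambda>x y z. T z x y"]) (rule T2 T3 T1; assumption)+
    have "(\<lambda>xs. T (xs ! 0) (xs ! 1) (xs ! 2)) [u, v, w] = (\<lambda>xs. T (xs ! 2) (xs ! 0) (xs ! 1)) [u, v, w]"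
    proof (rule G.multi_derivation_eqI[OF mT m])
      fix Xs assume "length Xs = 3" "set Xs \<subseteq> carrier cA"
      then obtain X Y Z where X: "Xs = [X, Y, Z]" "X \<in> carrier cA" "Y \<in> carrier cA" "Z \<in> carrier cA"
        using tuples_3[of Xs cA] by (auto simp: tuples_def)
      have "[X, Y] @ [Z] \<in> tuples cA 3"
        using X by (simp add: tuples_3)
      then have "\<tau> ([X, Y] @ [Z]) = \<tau> (Z # [X, Y])"
        using quasi_Lie unfolding quasi_Lie_pair_def cyclically_symmetric_def by blast
      then show "T (map itr Xs ! 0) (map itr Xs ! 1) (map itr Xs ! 2) =
          T (map itr Xs ! 2) (map itr Xs ! 0) (map itr Xs ! 1)"
        using X by (simp add: T)
    qed (use uvw in \<open>simp add: tuples_3\<close>)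
    then show ?thesis by simp
  qed

  let ?J = "\<lambda>u v w. B (B u v) w \<oplus>\<^bsub>TA\<^esub> B (B v w) u \<oplus>\<^bsub>TA\<^esub> B (B w u) v"
  \<comment> \<open>Rotating the arguments only permutes the three summands, so the derivation
    property in the first variable passes to the other two.\<close>
  have J_rot: "?J u v w = ?J v w u"
    if "u \<in> carrier TA" "v \<in> carrier TA" "w \<in> carrier TA" for u v w
    using that by (simp only: B_closed T.M.a_ac T.M.a_closed)
  have J1: "derivation R TA (\<lambda>u. ?J u v w)" if "v \<in> carrier TA" "w \<in> carrier TA" for v w
    by (rule T.jacobiator_derivation[OF Bl Br skew that])
  have J2: "derivation R TA (\<lambda>v. ?J u v w)" if "u \<in> carrier TA" "w \<in> carrier TA" for u w
    by (rule derivation_cong[OF J1[OF that(2,1)] T.ring_axioms T.module])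
      (rule J_rot[symmetric]; simp add: that)
  have J3: "derivation R TA (\<lambda>w. ?J u v w)" if "u \<in> carrier TA" "v \<in> carrier TA" for u v
    by (rule derivation_cong[OF J1[OF that] T.ring_axioms T.module])
      (rule J_rot; simp add: that)
  have jacobi: "?J u v w = T u v w \<ominus>\<^bsub>TA\<^esub> T w v u"
    if uvw: "u \<in> carrier TA" "v \<in> carrier TA" "w \<in> carrier TA" for u v w
  proof -
    have mJ: "multi_derivation R TA 3 (\<lambda>xs. ?J (xs ! 0) (xs ! 1) (xs ! 2))"
      by (rule multi_derivation_3[of _ _ ?J, OF J1 J2 J3])
    \<comment> \<open>The difference is written as a sum with a negative, to match the closure rules
      for derivations.\<close>
    have m: "multi_derivation R TA 3
        (\<lambda>xs. T (xs ! 0) (xs ! 1) (xs ! 2) \<oplus>\<^bsub>TA\<^esub> \<ominus>\<^bsub>TA\<^esub> T (xs ! 2) (xs ! 1) (xs ! 0))"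
      by (rule multi_derivation_3[of _ _ "\<lambda>x y z. T x y z \<oplus>\<^bsub>TA\<^esub> \<ominus>\<^bsub>TA\<^esub> T z y x"])
        (rule T.derivation_add T.derivation_minus T1 T2 T3; assumption?)+
    have "(\<lambda>xs. ?J (xs ! 0) (xs ! 1) (xs ! 2)) [u, v, w] =
        (\<lambda>xs. T (xs ! 0) (xs ! 1) (xs ! 2) \<oplus>\<^bsub>TA\<^esub> \<ominus>\<^bsub>TA\<^esub> T (xs ! 2) (xs ! 1) (xs ! 0)) [u, v, w]"
    proof (rule G.multi_derivation_eqI[OF mJ m])
      fix Xs assume "length Xs = 3" "set Xs \<subseteq> carrier cA"
      then obtain X Y Z where X: "Xs = [X, Y, Z]" "X \<in> carrier cA" "Y \<in> carrier cA" "Z \<in> carrier cA"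
        using tuples_3[of Xs cA] by (auto simp: tuples_def)
      have "\<beta> [\<beta> [X, Y], Z] \<oplus>\<^bsub>cA\<^esub> \<beta> [\<beta> [Y, Z], X] \<oplus>\<^bsub>cA\<^esub> \<beta> [\<beta> [Z, X], Y]
          = \<tau> [X, Y, Z] \<ominus>\<^bsub>cA\<^esub> \<tau> [Z, Y, X]"
        using quasi_Lie X(2-4) unfolding quasi_Lie_pair_def by blast
      then have "itr (\<beta> [\<beta> [X, Y], Z]) \<oplus>\<^bsub>TA\<^esub> itr (\<beta> [\<beta> [Y, Z], X]) \<oplus>\<^bsub>TA\<^esub> itr (\<beta> [\<beta> [Z, X], Y])
          = itr (\<tau> [X, Y, Z] \<oplus>\<^bsub>cA\<^esub> \<ominus>\<^bsub>cA\<^esub> \<tau> [Z, Y, X])"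
        using X(2-4) by (simp only: a_minus_def itr_add[symmetric] bracket_2_closed cA.M.a_closed)
      also have "\<dots> = itr (\<tau> [X, Y, Z]) \<oplus>\<^bsub>TA\<^esub> \<ominus>\<^bsub>TA\<^esub> itr (\<tau> [Z, Y, X])"
        using X(2-4) by (simp only: itr_add itr_minus bracket_3_closed cA.M.a_inv_closed)
      finally show "?J (map itr Xs ! 0) (map itr Xs ! 1) (map itr Xs ! 2) =
          T (map itr Xs ! 0) (map itr Xs ! 1) (map itr Xs ! 2) \<oplus>\<^bsub>TA\<^esub>
          \<ominus>\<^bsub>TA\<^esub> T (map itr Xs ! 2) (map itr Xs ! 1) (map itr Xs ! 0)"
        using X by (simp add: B T bracket_2_closed del: trace_algebra_ops)
    qed (use uvw in \<open>simp add: tuples_3\<close>)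
    then show ?thesis by (simp add: a_minus_def del: trace_algebra_ops)
  qed

  \<comment> \<open>The maps on elements become brackets on the singleton cosets.\<close>
  let ?\<beta> = "singleton_bracket R TA 2 (\<lambda>xs. B (xs ! 0) (xs ! 1))"
  let ?\<tau> = "singleton_bracket R TA 3 (\<lambda>xs. T (xs ! 0) (xs ! 1) (xs ! 2))"
  let ?cT = "check_module R TA"
  have \<beta>_eq: "?\<beta> [{u}, {v}] = {B u v}" if "u \<in> carrier TA" "v \<in> carrier TA" for u v
    using T.singleton_bracket_apply[of "[u, v]" 2] that by (simp add: tuples_2)
  have \<tau>_eq: "?\<tau> [{u}, {v}, {w}] = {T u v w}"
    if "u \<in> carrier TA" "v \<in> carrier TA" "w \<in> carrier TA" for u v w
    using T.singleton_bracket_apply[of "[u, v, w]" 3] that by (simp add: tuples_3)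
  have braces: "brace_in R TA 2 ?\<beta>" "brace_in R TA 3 ?\<tau>"
    using mB mT by (auto intro!: T.brace_singleton_bracket)
  have "quasi_Lie_pair R ?cT ?\<beta> ?\<tau>"
    unfolding quasi_Lie_pair_def
  proof (intro conjI ballI)
    show "bracket_in R ?cT 2 ?\<beta>" "bracket_in R ?cT 3 ?\<tau>"
      using braces by (simp_all add: brace_in_def)
    show "skew_symmetric ?cT ?\<beta>"
      unfolding skew_symmetric_def
    proof (intro ballI)
      fix U V assume "U \<in> carrier ?cT" "V \<in> carrier ?cT"
      then obtain u v where "u \<in> carrier TA" "U = {u}" "v \<in> carrier TA" "V = {v}"
        by (elim T.check_singleton_cases)
      then show "?\<beta> [U, V] = \<ominus>\<^bsub>?cT\<^esub> ?\<beta> [V, U]"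
        using skew[of u v] by (simp add: \<beta>_eq T.check_singleton_ops B_closed
            del: trace_algebra_ops One_nat_def)
    qed
    show "cyclically_symmetric ?cT 3 ?\<tau>"
      unfolding cyclically_symmetric_def
    proof (intro allI impI)
      fix Us W assume "Us @ [W] \<in> tuples ?cT 3"
      then obtain us where us: "us \<in> tuples TA 3" "Us @ [W] = map (\<lambda>x. {x}) us"
        unfolding T.tuples_check by (elim bexE)
      obtain u v w where uvw: "us = [u, v, w]" "u \<in> carrier TA" "v \<in> carrier TA" "w \<in> carrier TA"
        using us(1) tuples_3[of us TA] by blast
      \<comment> \<open>In this shape, comparing the last entries separates \<open>Us\<close> from
        \<open>W\<close>.\<close>
      have "Us @ [W] = [{u}, {v}] @ [{w}]"
        using us(2) uvw(1) by simp
      then have "Us = [{u}, {v}]" "W = {w}"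
        by (simp_all only: append1_eq_conv)
      then show "?\<tau> (Us @ [W]) = ?\<tau> (W # Us)"
        using cyclic[OF uvw(2-4)] uvw(2-4) by (simp add: \<tau>_eq del: One_nat_def)
    qed
    fix U V W assume "U \<in> carrier ?cT" "V \<in> carrier ?cT" "W \<in> carrier ?cT"
    then obtain u v w where u: "u \<in> carrier TA" "v \<in> carrier TA" "w \<in> carrier TA"
        and U: "U = {u}" "V = {v}" "W = {w}"
      by (elim T.check_singleton_cases)
    show "?\<beta> [?\<beta> [U, V], W] \<oplus>\<^bsub>?cT\<^esub> ?\<beta> [?\<beta> [V, W], U] \<oplus>\<^bsub>?cT\<^esub> ?\<beta> [?\<beta> [W, U], V]
        = ?\<tau> [U, V, W] \<ominus>\<^bsub>?cT\<^esub> ?\<tau> [W, V, U]"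
      using jacobi[OF u] u
      by (simp add: U \<beta>_eq \<tau>_eq T.check_singleton_ops B_closed T_closed a_minus_def
          del: trace_algebra_ops One_nat_def)
  qed
  with braces have "quasi_Poisson_algebra R TA ?\<beta> ?\<tau>"
    by (simp add: quasi_Poisson_algebra_def T.assoc_algebra)
  moreover have "check_tr \<in> linear_maps R cA ?cT"
    using linear_mapsD[OF induced_trace_linear]
      linear_mapsD[OF assoc_algebra.check_proj_linear[OF T.assoc_algebra]]
    by (intro linear_mapsI) (simp_all del: trace_algebra_ops)
  then have "quasi_Poisson_hom R A \<beta> \<tau> TA ?\<beta> ?\<tau> check_tr"
    unfolding quasi_Poisson_hom_def
    by (simp add: check_tr_eq \<beta>_eq \<tau>_eq B T itr_closed bracket_2_closed bracket_3_closed
        del: One_nat_def)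
  ultimately show ?thesis by blast
qed

text \<open>The homomorphism condition fixes both brackets on tuples of traces, and traces generate
  the trace algebra.\<close>

lemma trace_quasi_Poisson_unique:
  assumes 1: "quasi_Poisson_algebra R TA \<beta>1 \<tau>1" "quasi_Poisson_hom R A \<beta> \<tau> TA \<beta>1 \<tau>1 check_tr"
    and 2: "quasi_Poisson_algebra R TA \<beta>2 \<tau>2" "quasi_Poisson_hom R A \<beta> \<tau> TA \<beta>2 \<tau>2 check_tr"
  shows "\<beta>1 = \<beta>2" "\<tau>1 = \<tau>2"
proof -
  have hom: "\<beta>' [{itr X}, {itr Y}] = check_tr (\<beta> [X, Y])" "\<tau>' [{itr X}, {itr Y}, {itr Z}] = check_tr (\<tau> [X, Y, Z])"
    if "quasi_Poisson_hom R A \<beta> \<tau> TA \<beta>' \<tau>' check_tr"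
      "X \<in> carrier cA" "Y \<in> carrier cA" "Z \<in> carrier cA" for \<beta>' \<tau>' X Y Z
    using that unfolding quasi_Poisson_hom_def by (simp_all add: check_tr_eq)
  show "\<beta>1 = \<beta>2"
  proof (rule G.brace_eqI)
    fix Xs assume "length Xs = 2" "set Xs \<subseteq> carrier cA"
    then obtain X Y where X: "Xs = [X, Y]" "X \<in> carrier cA" "Y \<in> carrier cA"
      using tuples_2[of Xs cA] by (auto simp: tuples_def)
    \<comment> \<open>\<open>Y\<close> is passed twice because \<open>hom\<close> also expects a
      third class, absent from the identity for 2-brackets.\<close>
    show "\<beta>1 (map (\<lambda>X. {itr X}) Xs) = \<beta>2 (map (\<lambda>X. {itr X}) Xs)"
      using hom(1)[OF 1(2) X(2,3,3)] hom(1)[OF 2(2) X(2,3,3)] by (simp add: X(1))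
  qed (use 1 2 in \<open>simp_all add: quasi_Poisson_algebra_def\<close>)
  show "\<tau>1 = \<tau>2"
  proof (rule G.brace_eqI)
    fix Xs assume "length Xs = 3" "set Xs \<subseteq> carrier cA"
    then obtain X Y Z where X: "Xs = [X, Y, Z]" "X \<in> carrier cA" "Y \<in> carrier cA" "Z \<in> carrier cA"
      using tuples_3[of Xs cA] by (auto simp: tuples_def)
    show "\<tau>1 (map (\<lambda>X. {itr X}) Xs) = \<tau>2 (map (\<lambda>X. {itr X}) Xs)"
      using hom(2)[OF 1(2) X(2-4)] hom(2)[OF 2(2) X(2-4)] by (simp add: X(1))
  qed (use 1 2 in \<open>simp_all add: quasi_Poisson_algebra_def\<close>)
qed

end

end

text \<open>Existence and uniqueness are combined into one statement about pairs of brackets; the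
  algebra structure of \<open>A\<close> is part of the quasi-Poisson hypothesis.\<close>

theorem theorem3p3:
  fixes R :: "('r, 'x) ring_scheme" and A :: "('r, 'a, 'y) module_scheme" and n :: nat
    and \<beta> \<tau> :: "'a set list \<Rightarrow> 'a set"
  assumes "cring R" and "quasi_Poisson_algebra R A \<beta> \<tau>" and "n \<ge> 1"
  shows "\<exists>!(\<beta>', \<tau>').
    quasi_Poisson_algebra R (trace_algebra R A n) \<beta>' \<tau>' \<and>
    quasi_Poisson_hom R A \<beta> \<tau> (trace_algebra R A n) \<beta>' \<tau>'
      (\<lambda>X. check_proj R (trace_algebra R A n) (induced_trace R A n X))"
proof -
  interpret algebra_trace R A n
    using assms(2) by (simp add: algebra_trace_def quasi_Poisson_algebra_def)
  let ?P = "\<lambda>\<beta>' \<tau>'. quasi_Poisson_algebra R TA \<beta>' \<tau>' \<and> quasi_Poisson_hom R A \<beta> \<tau> TA \<beta>' \<tau>' check_tr"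
  obtain \<beta>' \<tau>' where P: "?P \<beta>' \<tau>'"
    using trace_quasi_Poisson_exists[OF assms(2)] by blast
  show ?thesis
  proof (rule ex1I[of _ "(\<beta>', \<tau>')"])
    show "case (\<beta>', \<tau>') of (\<beta>', \<tau>') \<Rightarrow> ?P \<beta>' \<tau>'"
      using P by simp
    fix p assume "case p of (\<beta>', \<tau>') \<Rightarrow> ?P \<beta>' \<tau>'"
    then have "?P (fst p) (snd p)"
      by (simp add: case_prod_beta)
    then have "fst p = \<beta>'" "snd p = \<tau>'"
      using trace_quasi_Poisson_unique[OF assms(2)] P by blast+
    then show "p = (\<beta>', \<tau>')"
      by (simp add: prod_eq_iff)
  qed
qed

end
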